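(* There is an algorithm in the local query model that, given an unweighted undirected graph $G$ with $n$ vertices and $m$ edges and a parameter $0<\varepsilon<1$, outputs a $(1\pm\varepsilon)$-multiplicative approximation of the size $k$ of the global minimum cut of $G$ with high constant probability, using $\tilde{O}\bigl(\frac{m}{\varepsilon^2 k}\bigr)$ queries in expectation.
   Context: Local query model: $G=(V,E)$ has known vertex set $V$ and unknown edge set $E$, accessed only through degree queries (given $u$, return its degree), edge queries (given $u$ and an index $i$, return the $i$-th neighbor of $u$, or $\bot$ if none), and adjacency queries (given $u,v$, return whether $(u,v)\in E$). $\tilde{O}$ hides logarithmic factors. *)

theory Defs
  imports "HOL-Probability.Probability"
begin

(* Graph in the local query model: vertex set {0..<n}; adjacency lists adj v
   (the order of adj v fixes the answers of edge queries). *)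
definition valid_graph :: "nat \<Rightarrow> (nat \<Rightarrow> nat list) \<Rightarrow> bool" where
  "valid_graph n adj \<longleftrightarrow>
     (\<forall>v. n \<le> v \<longrightarrow> adj v = []) \<and>
     (\<forall>v<n. distinct (adj v) \<and> set (adj v) \<subseteq> {0..<n} \<and> v \<notin> set (adj v) \<and>
            (\<forall>u\<in>set (adj v). v \<in> set (adj u)))"

definition edges :: "nat \<Rightarrow> (nat \<Rightarrow> nat list) \<Rightarrow> nat set set" where
  "edges n adj = {{u, v} | u v. u < n \<and> v \<in> set (adj u)}"

definition num_edges :: "nat \<Rightarrow> (nat \<Rightarrow> nat list) \<Rightarrow> nat" where
  "num_edges n adj = card (edges n adj)"

definition cut_size :: "(nat \<Rightarrow> nat list) \<Rightarrow> nat set \<Rightarrow> nat" where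
  "cut_size adj S = card {(u, v). u \<in> S \<and> v \<notin> S \<and> v \<in> set (adj u)}"

definition min_cut :: "nat \<Rightarrow> (nat \<Rightarrow> nat list) \<Rightarrow> nat" where
  "min_cut n adj = Min {cut_size adj S | S. S \<subseteq> {0..<n} \<and> S \<noteq> {} \<and> S \<noteq> {0..<n}}"

datatype 'r qalg =
    Return 'r
  | DegQ nat "nat \<Rightarrow> 'r qalg"
  | NbrQ nat nat "nat option \<Rightarrow> 'r qalg"
  | AdjQ nat nat "bool \<Rightarrow> 'r qalg"

primrec run :: "(nat \<Rightarrow> nat list) \<Rightarrow> 'r qalg \<Rightarrow> 'r \<times> nat" where
  "run adj (Return r) = (r, 0)"
| "run adj (DegQ u k) = (let (r, q) = run adj (k (length (adj u))) in (r, Suc q))"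
| "run adj (NbrQ u i k) =
     (let (r, q) = run adj (k (if i < length (adj u) then Some (adj u ! i) else None)) in (r, Suc q))"
| "run adj (AdjQ u v k) = (let (r, q) = run adj (k (v \<in> set (adj u))) in (r, Suc q))"

(* A randomized query algorithm is a probability distribution over decision trees. *)
definition expected_queries :: "'r qalg pmf \<Rightarrow> (nat \<Rightarrow> nat list) \<Rightarrow> ennreal" where
  "expected_queries A adj = (\<integral>\<^sup>+ T. ennreal (real (snd (run adj T))) \<partial>measure_pmf A)"

definition success_prob :: "'r qalg pmf \<Rightarrow> (nat \<Rightarrow> nat list) \<Rightarrow> ('r \<Rightarrow> bool) \<Rightarrow> real" where
  "success_prob A adj P = measure_pmf.prob A {T. P (fst (run adj T))}"

end

theory Submission
  imports Defs
begin

text \<open>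
  Query all degrees, then try the guesses \<open>n, n/2, n/4, \<dots>\<close> for \<open>k\<close>. For a guess \<open>t\<close>,
  probe every adjacency-list slot independently with probability \<open>min 1 (L / (\<epsilon>\<^sup>2 t))\<close>,
  where \<open>L\<close> is of order \<open>log n\<close>, and compute the rescaled minimum cut of the sample. Accept it as
  the answer once it is at least \<open>t/2\<close>. At rate 1 the sample is the whole graph and
  is accepted unconditionally. At a smaller rate and for \<open>t \<ge> 8k\<close>, a single minimum cut already makes
  the sample fail the test, by Chernoff. For \<open>t \<le> 8k\<close> all sampled cuts are at least \<open>1 - \<epsilon>/2\<close> times their
  expectation and one minimum cut is not too large, so the answer is correct if accepted, and it is
  accepted if \<open>t \<le> k\<close>. The expected numbers of queries form a geometric sum dominated by the last
  guess, which with high probability is at least \<open>k/2\<close>.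

  The union bound over all cuts replaces Karger's bound on the number of near-minimum cuts by a
  direct estimate of the sum of \<open>exp (- \<beta> c(T))\<close> over all cuts \<open>T\<close>: average over the contraction of a
  uniformly random edge and induct on the number of vertices.
\<close>

section \<open>Exponential sums over the cuts of a multigraph\<close>

text \<open>Contraction changes only the end maps \<open>s\<close> and \<open>t\<close>, so
  \<open>E\<close> stays fixed while loops and parallel arcs appear. An undirected edge is a pair of
  opposite arcs; the induction uses of this only that a set and its complement have equal
  cuts.\<close>

definition multicut :: "'e set \<Rightarrow> ('e \<Rightarrow> 'v) \<Rightarrow> ('e \<Rightarrow> 'v) \<Rightarrow> 'v set \<Rightarrow> nat" where
  "multicut E s t T = card {e \<in> E. s e \<in> T \<and> t e \<notin> T}"

definition proper_cuts :: "'v set \<Rightarrow> 'v set set" where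
  "proper_cuts W = {T. T \<subseteq> W \<and> T \<noteq> {} \<and> T \<noteq> W}"

lemma finite_proper_cuts [simp]: "finite W \<Longrightarrow> finite (proper_cuts W)"
  unfolding proper_cuts_def by (rule finite_subset[of _ "Pow W"]) auto

lemma proper_cuts_compl: "T \<in> proper_cuts W \<Longrightarrow> W - T \<in> proper_cuts W"
  unfolding proper_cuts_def by auto

text \<open>A non-loop arc leaves exactly one singleton, that of its source.\<close>

lemma sum_multicut_singletons:
  assumes "finite E" "finite W" "s ` E \<subseteq> W"
  shows "(\<Sum>w\<in>W. multicut E s t {w}) = card {e \<in> E. s e \<noteq> t e}"
proof -
  have "card {e \<in> E. s e \<noteq> t e} = (\<Sum>w\<in>W. card {e \<in> {e \<in> E. s e \<noteq> t e}. s e = w})"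
    using assms by (subst card_eq_sum, subst sum.group[symmetric, where T = W and g = s]) auto
  also have "\<dots> = (\<Sum>w\<in>W. multicut E s t {w})"
    unfolding multicut_def by (intro sum.cong refl arg_cong[where f = card]) auto
  finally show ?thesis by simp
qed

text \<open>By the symmetry hypothesis as many arcs enter \<open>T\<close> as leave it. The arcs
  counted here are those whose contraction preserves \<open>T\<close>.\<close>

lemma card_uncut_edges:
  assumes "finite E" "s ` E \<subseteq> W" "t ` E \<subseteq> W"
    and "multicut E s t (W - T) = multicut E s t T"
  shows "real (card {e \<in> E. s e \<noteq> t e \<and> (s e \<in> T \<longleftrightarrow> t e \<in> T)}) =
    real (card {e \<in> E. s e \<noteq> t e}) - 2 * real (multicut E s t T)"
proof -
  let ?A = "{e \<in> E. s e \<in> T \<and> t e \<notin> T}" and ?B = "{e \<in> E. s e \<notin> T \<and> t e \<in> T}"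
    and ?C = "{e \<in> E. s e \<noteq> t e \<and> (s e \<in> T \<longleftrightarrow> t e \<in> T)}"
  have B: "card ?B = multicut E s t T"
    unfolding assms(4)[symmetric] unfolding multicut_def using assms(2,3)
    by (intro arg_cong[where f = card]) auto
  have "card {e \<in> E. s e \<noteq> t e} = card (?A \<union> ?B \<union> ?C)"
    by (intro arg_cong[where f = card]) auto
  also have "\<dots> = card (?A \<union> ?B) + card ?C"
    using assms(1) by (intro card_Un_disjoint) auto
  also have "card (?A \<union> ?B) = card ?A + card ?B"
    using assms(1) by (intro card_Un_disjoint) auto
  finally show ?thesis using B unfolding multicut_def by simp
qed

text \<open>Contracting \<open>x\<close> into \<open>y\<close> removes \<open>x\<close> from the
  vertex set; this map puts it back on the side of \<open>y\<close>. It is inverse to removal of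
  \<open>x\<close> and matches the cuts of the contracted graph with the cuts that do not separate
  \<open>x\<close> and \<open>y\<close>.\<close>

definition expand :: "'v \<Rightarrow> 'v \<Rightarrow> 'v set \<Rightarrow> 'v set" where
  "expand x y T = (if y \<in> T then insert x T else T)"

lemma expand_proper_cut:
  assumes "x \<in> W" "y \<in> W" "x \<noteq> y" "T \<in> proper_cuts (W - {x})"
  shows "expand x y T \<in> proper_cuts W" "x \<in> expand x y T \<longleftrightarrow> y \<in> expand x y T"
    "expand x y T - {x} = T" "W - expand x y T = expand x y ((W - {x}) - T)"
  using assms unfolding expand_def proper_cuts_def by auto

lemma expand_remove:
  assumes "x \<in> W" "y \<in> W" "x \<noteq> y" "T \<in> proper_cuts W" "x \<in> T \<longleftrightarrow> y \<in> T"
  shows "T - {x} \<in> proper_cuts (W - {x})" "expand x y (T - {x}) = T"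
  using assms unfolding expand_def proper_cuts_def by auto

lemma multicut_contract:
  assumes "x \<notin> T" "x \<noteq> y"
  shows "multicut E ((\<lambda>z. if z = x then y else z) \<circ> s) ((\<lambda>z. if z = x then y else z) \<circ> t) T =
    multicut E s t (expand x y T)"
  unfolding multicut_def expand_def using assms
  by (intro arg_cong[where f = card]) auto

text \<open>For \<open>x \<le> 1/2\<close>,
  \<open>1/(1 - x) \<le> 1 + 2x \<le> exp (2x)\<close>.\<close>

lemma exp_minus_le_one_minus_half:
  fixes x :: real assumes "0 \<le> x" "x \<le> 1 / 2" shows "exp (- 2 * x) \<le> 1 - x"
proof -
  have "1 / (1 - x) = 1 + x / (1 - x)" using assms by (simp add: field_simps)
  also have "\<dots> \<le> 1 + 2 * x" using assms mult_left_mono[of "2 * x" 1 x]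
    by (simp add: field_simps)
  also have "\<dots> \<le> exp (2 * x)" by (rule exp_ge_add_one_self)
  finally have "1 \<le> (1 - x) * exp (2 * x)" using assms by (simp add: field_simps)
  then have "exp (-2 * x) * 1 \<le> exp (-2 * x) * ((1 - x) * exp (2 * x))"
    by (intro mult_left_mono) auto
  also have "\<dots> = 1 - x" by (simp add: exp_minus field_simps)
  finally show ?thesis by simp
qed

text \<open>
  A cut \<open>T\<close> survives the contraction of a random non-loop edge with probability \<open>1 - 2 c(T) / M\<close>,
  where \<open>M \<ge> R k\<close> for \<open>R\<close> vertices. If \<open>4 c(T) \<le> M\<close>, this is at least \<open>exp (- 4 c(T) / (R k))\<close>, which
  pays for the step from \<open>ln (B (R - 1))\<close> to \<open>ln (B R)\<close> in the exponent. The at most \<open>2 ^ R\<close>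
  remaining cuts are so large that they contribute at most \<open>1 / B\<^sup>2\<close> in total.
\<close>

lemma sum_exp_multicut_le:
  fixes k B :: real
  assumes "finite E" "finite W" "s ` E \<subseteq> W" "t ` E \<subseteq> W" "0 < k" "1 \<le> B"
    and "\<And>T. T \<in> proper_cuts W \<Longrightarrow> k \<le> real (multicut E s t T)"
    and "\<And>T. T \<in> proper_cuts W \<Longrightarrow> multicut E s t (W - T) = multicut E s t T"
  shows "(\<Sum>T\<in>proper_cuts W. exp (- (4 / k * ln (B * real (card W)) * real (multicut E s t T))))
    \<le> real (card W) / B\<^sup>2"
  using assms
proof (induction "card W" arbitrary: W s t)
  case 0
  then show ?case by (simp add: proper_cuts_def)
next
  case (Suc r)
  note finE = \<open>finite E\<close> and finW = \<open>finite W\<close> and k = \<open>0 < k\<close> and B = \<open>1 \<le> B\<close>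
  note lower = Suc.prems(7) and sym = Suc.prems(8)
  define c where "c T = real (multicut E s t T)" for T
  define M where "M = real (card {e \<in> E. s e \<noteq> t e})"
  have R: "card W = Suc r" using Suc.hyps by simp
  show ?case
  proof (cases "r = 0")
    case True
    then obtain w where "W = {w}" using R by (metis One_nat_def card_1_singletonE)
    then have "proper_cuts W = {}" by (auto simp: proper_cuts_def)
    then show ?thesis by simp
  next
    case False
    define R where "R = real (Suc r)"
    have R2: "R \<ge> 2" using False by (simp add: R_def)
    define \<beta>' where "\<beta>' = 4 / k * ln (B * real r)"
    define \<beta> where "\<beta> = 4 / k * ln (B * R)"
    have single: "{w} \<in> proper_cuts W" if "w \<in> W" for w
      using that R False by (auto simp: proper_cuts_def)
    \<comment> \<open>Every singleton is a proper cut, so at least \<open>k\<close> non-loop arcs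
      start at each vertex.\<close>
    have "R * k = (\<Sum>w\<in>W. k)" by (simp add: R R_def)
    also have "\<dots> \<le> (\<Sum>w\<in>W. real (multicut E s t {w}))"
      by (intro sum_mono lower single)
    also have "\<dots> = M"
      unfolding M_def using sum_multicut_singletons[OF finE finW Suc.prems(3), of t]
      by (metis of_nat_sum)
    finally have M: "R * k \<le> M" .
    have M0: "M > 0" using M R2 k by (smt (verit) mult_pos_pos)

    \<comment> \<open>The induction hypothesis applies to the graph with \<open>s e\<close> merged
      into \<open>t e\<close>: its cuts are cuts of the original graph, so the lower bound
      \<open>k\<close> persists.\<close>
    have contract: "(\<Sum>T\<in>{T \<in> proper_cuts W. s e \<in> T \<longleftrightarrow> t e \<in> T}. exp (- (\<beta>' * c T))) \<le> real r / B\<^sup>2"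
      if e: "e \<in> E" "s e \<noteq> t e" for e
    proof -
      define x where "x = s e"
      define y where "y = t e"
      have xy: "x \<in> W" "y \<in> W" "x \<noteq> y" using e Suc.prems(3,4) by (auto simp: x_def y_def)
      let ?g = "\<lambda>z. if z = x then y else z"
      have card': "r = card (W - {x})" using xy R finW by simp
      have mc: "multicut E (?g \<circ> s) (?g \<circ> t) T = multicut E s t (expand x y T)"
        if "T \<in> proper_cuts (W - {x})" for T
        using that xy by (intro multicut_contract) (auto simp: proper_cuts_def)
      have "(\<Sum>T\<in>{T \<in> proper_cuts W. x \<in> T \<longleftrightarrow> y \<in> T}. exp (- (\<beta>' * c T))) =
        (\<Sum>T\<in>proper_cuts (W - {x}). exp (- (\<beta>' * real (multicut E (?g \<circ> s) (?g \<circ> t) T))))"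
        by (rule sum.reindex_bij_witness[of _ "expand x y" "\<lambda>T. T - {x}"])
          (use xy expand_proper_cut(2)[OF xy] in \<open>auto simp: expand_proper_cut expand_remove mc c_def\<close>)
      also have "\<dots> \<le> real (card (W - {x})) / B\<^sup>2"
        unfolding \<beta>'_def card'
      proof (rule Suc.hyps(1)[OF card' finE])
        show "(?g \<circ> s) ` E \<subseteq> W - {x}" "(?g \<circ> t) ` E \<subseteq> W - {x}"
          using Suc.prems(3,4) xy by auto
        fix T assume T: "T \<in> proper_cuts (W - {x})"
        show "k \<le> real (multicut E (?g \<circ> s) (?g \<circ> t) T)"
          using T xy by (simp add: mc lower expand_proper_cut)
        show "multicut E (?g \<circ> s) (?g \<circ> t) (W - {x} - T) = multicut E (?g \<circ> s) (?g \<circ> t) T"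
          by (simp only: mc[OF T] mc[OF proper_cuts_compl[OF T]]
            expand_proper_cut(4)[OF xy T, symmetric] sym[OF expand_proper_cut(1)[OF xy T]])
      qed (use finW k B in auto)
      also have "real (card (W - {x})) = real r" using card' by simp
      finally show ?thesis by (simp add: x_def y_def)
    qed

    \<comment> \<open>The threshold keeps \<open>2 * c T / M\<close> within 1/2, the range of
      \<open>exp_minus_le_one_minus_half\<close>.\<close>
    let ?S = "{T \<in> proper_cuts W. 4 * c T \<le> M}" and ?L = "{T \<in> proper_cuts W. \<not> 4 * c T \<le> M}"
    let ?N = "{e \<in> E. s e \<noteq> t e}"
    \<comment> \<open>This is \<open>ln z \<le> z - 1\<close> at \<open>z = r / R\<close>.\<close>
    have ln_step: "1 / R \<le> ln R - ln (real r)"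
    proof -
      have "ln (real r / R) \<le> real r / R - 1"
        using False by (intro ln_le_minus_one) (auto simp: R_def)
      also have "\<dots> = - (1 / R)" by (simp add: R_def field_simps)
      finally show ?thesis using False by (simp add: ln_div R_def)
    qed
    have small: "exp (- (\<beta> * c T)) * M \<le> exp (- (\<beta>' * c T)) * (M - 2 * c T)" if "T \<in> ?S" for T
    proof -
      have c0: "0 \<le> c T" by (simp add: c_def)
      have "\<beta> - \<beta>' = 4 / k * (ln R - ln (real r))"
      proof -
        have "ln (B * R) - ln (B * real r) = ln R - ln (real r)"
          using B R2 False by (simp add: ln_mult_pos)
        then show ?thesis unfolding \<beta>_def \<beta>'_def by (metis right_diff_distrib)
      qed
      also have "\<dots> \<ge> 4 / k * (1 / R)" using k by (intro mult_left_mono ln_step) auto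
      finally have "(\<beta> - \<beta>') * c T \<ge> 4 / k * (1 / R) * c T"
        using c0 by (intro mult_right_mono) auto
      moreover have "4 / k * (1 / R) * c T = 4 * c T / (R * k)" by simp
      moreover have "4 * c T / M \<le> 4 * c T / (R * k)"
        using M M0 k R2 c0 by (intro divide_left_mono) auto
      ultimately have "- (\<beta> * c T) \<le> - (\<beta>' * c T) + - 2 * (2 * c T / M)"
        unfolding left_diff_distrib by linarith
      then have "exp (- (\<beta> * c T)) \<le> exp (- (\<beta>' * c T)) * exp (- 2 * (2 * c T / M))"
        by (simp add: exp_add[symmetric])
      also have "\<dots> \<le> exp (- (\<beta>' * c T)) * (1 - 2 * c T / M)"
        using that M0 c0 by (intro mult_left_mono exp_minus_le_one_minus_half) auto
      finally have "exp (- (\<beta> * c T)) * M \<le> exp (- (\<beta>' * c T)) * (1 - 2 * c T / M) * M"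
        using M0 by (intro mult_right_mono) auto
      also have "\<dots> = exp (- (\<beta>' * c T)) * (M - 2 * c T)" using M0 by (simp add: field_simps)
      finally show ?thesis .
    qed
    have "(\<Sum>T\<in>?S. exp (- (\<beta> * c T))) * M \<le> (\<Sum>T\<in>?S. exp (- (\<beta>' * c T)) * (M - 2 * c T))"
      unfolding sum_distrib_right by (intro sum_mono small)
    \<comment> \<open>Double counting: \<open>M - 2 * c T\<close> is the number of non-loop arcs not
      crossing \<open>T\<close>. After the sums are exchanged, each arc contributes one sum bounded
      by \<open>contract\<close>.\<close>
    also have "\<dots> \<le> (\<Sum>T\<in>proper_cuts W. exp (- (\<beta>' * c T)) *
        real (card {e \<in> E. s e \<noteq> t e \<and> (s e \<in> T \<longleftrightarrow> t e \<in> T)}))"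
    proof -
      have "(\<Sum>T\<in>?S. exp (- (\<beta>' * c T)) * (M - 2 * c T)) = (\<Sum>T\<in>?S. exp (- (\<beta>' * c T)) *
          real (card {e \<in> E. s e \<noteq> t e \<and> (s e \<in> T \<longleftrightarrow> t e \<in> T)}))"
        unfolding M_def c_def
        by (intro sum.cong refl, subst card_uncut_edges[OF finE Suc.prems(3,4)]) (auto simp: sym)
      also have "\<dots> \<le> (\<Sum>T\<in>proper_cuts W. exp (- (\<beta>' * c T)) *
          real (card {e \<in> E. s e \<noteq> t e \<and> (s e \<in> T \<longleftrightarrow> t e \<in> T)}))"
        using finW by (intro sum_mono2) auto
      finally show ?thesis .
    qed
    also have "\<dots> = (\<Sum>T\<in>proper_cuts W. \<Sum>e\<in>?N. if s e \<in> T \<longleftrightarrow> t e \<in> T then exp (- (\<beta>' * c T)) else 0)"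
    proof (intro sum.cong refl)
      fix T
      have "{e \<in> E. s e \<noteq> t e \<and> (s e \<in> T \<longleftrightarrow> t e \<in> T)} = ?N \<inter> {e. s e \<in> T \<longleftrightarrow> t e \<in> T}" by auto
      then show "exp (- (\<beta>' * c T)) * real (card {e \<in> E. s e \<noteq> t e \<and> (s e \<in> T \<longleftrightarrow> t e \<in> T)}) =
          (\<Sum>e\<in>?N. if s e \<in> T \<longleftrightarrow> t e \<in> T then exp (- (\<beta>' * c T)) else 0)"
        using finE by (simp add: sum.If_cases)
    qed
    also have "\<dots> = (\<Sum>e\<in>?N. \<Sum>T\<in>proper_cuts W. if s e \<in> T \<longleftrightarrow> t e \<in> T then exp (- (\<beta>' * c T)) else 0)"
      by (rule sum.swap)
    also have "\<dots> \<le> (\<Sum>e\<in>?N. real r / B\<^sup>2)"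
    proof (intro sum_mono)
      fix e assume "e \<in> ?N"
      then show "(\<Sum>T\<in>proper_cuts W. if s e \<in> T \<longleftrightarrow> t e \<in> T then exp (- (\<beta>' * c T)) else 0)
          \<le> real r / B\<^sup>2"
        using contract[of e] finW by (simp add: sum.inter_filter)
    qed
    also have "\<dots> = real r / B\<^sup>2 * M" by (simp add: M_def)
    finally have S: "(\<Sum>T\<in>?S. exp (- (\<beta> * c T))) \<le> real r / B\<^sup>2"
      using M0 by (rule mult_right_le_imp_le)

    \<comment> \<open>Here \<open>4 * c T > M \<ge> R * k\<close>, so \<open>\<beta> * c T\<close>
      is at least \<open>R * ln (B * R)\<close>, and \<open>R\<close> is the exponent
      \<open>Suc r\<close>.\<close>
    have large: "exp (- (\<beta> * c T)) \<le> (1 / (B * R)) ^ Suc r" if "T \<in> ?L" for T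
    proof -
      have BR: "B * R \<ge> 1" using B R2 mult_mono[of 1 B 1 R] by simp
      have "R * k \<le> 4 * c T" using that M by auto
      then have "ln (B * R) * R \<le> ln (B * R) * (4 * c T / k)"
        using k BR by (intro mult_left_mono) (auto simp: field_simps)
      then have "- (\<beta> * c T) \<le> - (ln (B * R) * R)" by (simp add: \<beta>_def mult_ac)
      then have "exp (- (\<beta> * c T)) \<le> exp (- ln (B * R)) ^ Suc r"
        unfolding exp_of_nat_mult[symmetric] by (simp add: R_def mult_ac)
      also have "exp (- ln (B * R)) = 1 / (B * R)" using BR by (simp add: exp_minus inverse_eq_divide)
      finally show ?thesis .
    qed
    have "card ?L \<le> card (Pow W)" using finW by (intro card_mono) (auto simp: proper_cuts_def)
    then have cL: "real (card ?L) \<le> 2 ^ Suc r"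
      using finW R by (metis card_Pow of_nat_le_iff of_nat_numeral of_nat_power)
    have "(\<Sum>T\<in>?L. exp (- (\<beta> * c T))) \<le> real (card ?L) * (1 / (B * R)) ^ Suc r"
      using sum_bounded_above[of ?L, OF large] by simp
    also have "\<dots> \<le> 2 ^ Suc r * (1 / (B * R)) ^ Suc r"
      using B R2 by (intro mult_right_mono cL) auto
    also have "\<dots> = (2 / (B * R)) ^ Suc r" by (simp add: power_divide)
    \<comment> \<open>\<open>R \<ge> 2\<close> absorbs the factor 2. Since \<open>r \<ge> 1\<close>
      and \<open>B \<ge> 1\<close>, the exponent may then be lowered to 2.\<close>
    also have "\<dots> \<le> (1 / B) ^ Suc r"
      using B R2 by (intro power_mono) (auto simp: field_simps)
    also have "\<dots> \<le> (1 / B) ^ 2"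
      using B False by (intro power_decreasing) auto
    finally have L: "(\<Sum>T\<in>?L. exp (- (\<beta> * c T))) \<le> 1 / B\<^sup>2" by (simp add: power_divide)
    have "(\<Sum>T\<in>proper_cuts W. exp (- (\<beta> * c T))) =
        (\<Sum>T\<in>?S. exp (- (\<beta> * c T))) + (\<Sum>T\<in>?L. exp (- (\<beta> * c T)))"
      using finW by (subst sum.union_disjoint[symmetric]) (auto intro!: sum.cong)
    also have "\<dots> \<le> real r / B\<^sup>2 + 1 / B\<^sup>2" using S L by simp
    also have "\<dots> = R / B\<^sup>2" by (simp add: R_def add_divide_distrib)
    finally show ?thesis by (simp add: R \<beta>_def c_def R_def)
  qed
qed

section \<open>Chernoff bounds for products of Bernoulli distributions\<close>

text \<open>The product of \<open>1 - x + x^2/2\<close> and \<open>1 + x + x^2/2\<close> is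
  \<open>1 + x^4/4\<close>, and the second factor is at most \<open>exp x\<close>.\<close>

lemma exp_minus_le_quadratic:
  fixes x :: real assumes "0 \<le> x" shows "exp (- x) \<le> 1 - x + x\<^sup>2 / 2"
proof -
  have pos: "0 \<le> 1 - x + x\<^sup>2 / 2" using sum_squares_ge_zero[of "x - 1" 1]
    by (simp add: power2_eq_square algebra_simps)
  have "1 \<le> (1 - x + x\<^sup>2 / 2) * (1 + x + x\<^sup>2 / 2)"
    using zero_le_power[of "x\<^sup>2" 2] by (simp add: power2_eq_square algebra_simps)
  also have "\<dots> \<le> (1 - x + x\<^sup>2 / 2) * exp x"
    using assms pos by (intro mult_left_mono exp_lower_Taylor_quadratic) auto
  finally show ?thesis by (simp add: exp_minus field_simps)
qed

lemma real_card_Collect: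
  "finite F \<Longrightarrow> real (card {a \<in> F. P a}) = (\<Sum>a\<in>F. of_bool (P a))"
  by (simp add: Collect_conj_eq)

lemma expectation_Pi_bernoulli_component:
  assumes "finite A" "a \<in> A" "0 \<le> q a" "q a \<le> 1"
  shows "measure_pmf.expectation (Pi_pmf A False (\<lambda>a. bernoulli_pmf (q a))) (\<lambda>\<omega>. of_bool (\<omega> a) :: real) = q a"
proof -
  have "measure_pmf.expectation (Pi_pmf A False (\<lambda>a. bernoulli_pmf (q a))) (\<lambda>\<omega>. of_bool (\<omega> a) :: real) =
    measure_pmf.expectation (map_pmf (\<lambda>\<omega>. \<omega> a) (Pi_pmf A False (\<lambda>a. bernoulli_pmf (q a)))) of_bool"
    by simp
  also have "\<dots> = q a" using assms by (subst Pi_pmf_component) auto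
  finally show ?thesis .
qed

lemma expectation_Pi_bernoulli_card:
  assumes "finite A" "F \<subseteq> A" "\<And>a. a \<in> A \<Longrightarrow> 0 \<le> q a \<and> q a \<le> 1" "\<And>a. a \<in> F \<Longrightarrow> q a = p"
  shows "measure_pmf.expectation (Pi_pmf A False (\<lambda>a. bernoulli_pmf (q a)))
    (\<lambda>\<omega>. real (card {a \<in> F. \<omega> a})) = p * real (card F)"
proof -
  have F: "finite F" using assms finite_subset by blast
  have "measure_pmf.expectation (Pi_pmf A False (\<lambda>a. bernoulli_pmf (q a)))
      (\<lambda>\<omega>. real (card {a \<in> F. \<omega> a})) =
    (\<Sum>a\<in>F. measure_pmf.expectation (Pi_pmf A False (\<lambda>a. bernoulli_pmf (q a)))
      (\<lambda>\<omega>. of_bool (\<omega> a) :: real))"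
    unfolding real_card_Collect[OF F]
    by (intro Bochner_Integration.integral_sum measure_pmf.integrable_const_bound[where B = 1]) auto
  also have "\<dots> = (\<Sum>a\<in>F. q a)"
    using assms by (intro sum.cong refl expectation_Pi_bernoulli_component) auto
  finally show ?thesis using assms(4) by simp
qed

text \<open>Markov's inequality for the exponential moment. The sign of \<open>l\<close> is free, so
  one bound serves both tails. Only the coins in \<open>F\<close> share the rate \<open>p\<close>;
  coins of other levels have other rates.\<close>

lemma Pi_bernoulli_tail:
  fixes l p x :: real
  assumes "finite A" "F \<subseteq> A" "\<And>a. a \<in> A \<Longrightarrow> 0 \<le> q a \<and> q a \<le> 1" "\<And>a. a \<in> F \<Longrightarrow> q a = p"
  shows "measure_pmf.prob (Pi_pmf A False (\<lambda>a. bernoulli_pmf (q a)))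
      {\<omega>. x \<le> l * real (card {a \<in> F. \<omega> a})} \<le> exp (p * real (card F) * (exp l - 1) - x)"
proof -
  let ?M = "Pi_pmf A False (\<lambda>a. bernoulli_pmf (q a))"
  \<comment> \<open>The factor 1 outside \<open>F\<close> extends the product to the whole index
    set, where independence factorises the expectation.\<close>
  let ?Y = "\<lambda>\<omega>. \<Prod>a\<in>A. if a \<in> F then exp (l * of_bool (\<omega> a)) else 1"
  have F: "finite F" using assms finite_subset by blast
  have Y: "exp (l * real (card {a \<in> F. \<omega> a})) = ?Y \<omega>" for \<omega>
  proof -
    have "?Y \<omega> = (\<Prod>a\<in>F. exp (l * of_bool (\<omega> a)))"
      using assms(1,2) by (simp add: prod.If_cases Int_absorb1 Int_absorb2)
    then show ?thesis unfolding real_card_Collect[OF F] sum_distrib_left exp_sum[OF F] by simp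
  qed
  have int: "integrable ?M ?Y"
    unfolding Y[symmetric]
  proof (rule measure_pmf.integrable_const_bound[where B = "exp (\<bar>l\<bar> * real (card F))"])
    show "AE \<omega> in ?M. norm (exp (l * real (card {a \<in> F. \<omega> a}))) \<le> exp (\<bar>l\<bar> * real (card F))"
    proof (rule AE_I2)
      fix \<omega> :: "'a \<Rightarrow> bool"
      have "l * real (card {a \<in> F. \<omega> a}) \<le> \<bar>l\<bar> * real (card F)"
        using F by (intro mult_mono) (auto intro: card_mono)
      then show "norm (exp (l * real (card {a \<in> F. \<omega> a}))) \<le> exp (\<bar>l\<bar> * real (card F))" by simp
    qed
  qed simp
  have "measure_pmf.expectation ?M ?Y = (\<Prod>a\<in>A. measure_pmf.expectation (bernoulli_pmf (q a))
      (\<lambda>b. if a \<in> F then exp (l * of_bool b) else 1))"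
    using assms(1) by (intro expectation_prod_Pi_pmf) (auto intro: integrable_measure_pmf_finite)
  also have "\<dots> = (\<Prod>a\<in>A. if a \<in> F then 1 + p * (exp l - 1) else 1)"
    using assms(2-4) by (intro prod.cong refl) (auto simp: algebra_simps)
  also have "\<dots> = (1 + p * (exp l - 1)) ^ card F"
    using assms(1,2) by (simp add: prod.If_cases Int_absorb1 Int_absorb2)
  also have "\<dots> \<le> exp (p * (exp l - 1)) ^ card F"
  proof (cases "F = {}")
    \<comment> \<open>A coin in \<open>F\<close> gives \<open>0 \<le> p \<le> 1\<close>, so the base
      is nonnegative even for negative \<open>l\<close>. For empty \<open>F\<close> both powers are
      1.\<close>
    case False
    then have "0 \<le> p" "p \<le> 1" using assms(2-4) by auto
    then have "0 \<le> (1 - p) + p * exp l" by simp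
    then have "0 \<le> 1 + p * (exp l - 1)" by (simp add: algebra_simps)
    then show ?thesis by (intro power_mono exp_ge_add_one_self)
  qed simp
  also have "\<dots> = exp (p * real (card F) * (exp l - 1))"
    by (simp add: exp_of_nat_mult[symmetric] mult_ac)
  finally have mgf: "measure_pmf.expectation ?M ?Y \<le> exp (p * real (card F) * (exp l - 1))" .
  have "measure_pmf.prob ?M {\<omega>. x \<le> l * real (card {a \<in> F. \<omega> a})} =
      measure_pmf.expectation ?M (indicator {\<omega>. x \<le> l * real (card {a \<in> F. \<omega> a})})"
    by simp
  also have "\<dots> \<le> measure_pmf.expectation ?M (\<lambda>\<omega>. exp (- x) * ?Y \<omega>)"
  proof (rule integral_mono)
    show "indicator {\<omega>. x \<le> l * real (card {a \<in> F. \<omega> a})} \<omega> \<le> exp (- x) * ?Y \<omega>" for \<omega>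
      unfolding Y[symmetric] by (auto simp: indicator_def exp_add[symmetric])
    show "integrable ?M (indicator {\<omega>. x \<le> l * real (card {a \<in> F. \<omega> a})} :: _ \<Rightarrow> real)"
      by (rule measure_pmf.integrable_const_bound[where B = 1]) (auto simp: indicator_def)
  qed (use int in auto)
  also have "\<dots> \<le> exp (- x) * exp (p * real (card F) * (exp l - 1))"
    using mgf by simp
  finally show ?thesis by (simp add: exp_add[symmetric])
qed

text \<open>Take \<open>l = - e\<close>; then
  \<open>- e + e^2/2 + e * (1 - e) = - e^2/2\<close>.\<close>

lemma Pi_bernoulli_lower_tail:
  fixes p e :: real
  assumes "finite A" "F \<subseteq> A" "\<And>a. a \<in> A \<Longrightarrow> 0 \<le> q a \<and> q a \<le> 1" "\<And>a. a \<in> F \<Longrightarrow> q a = p"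
    and "0 \<le> p" "0 \<le> e"
  shows "measure_pmf.prob (Pi_pmf A False (\<lambda>a. bernoulli_pmf (q a)))
      {\<omega>. real (card {a \<in> F. \<omega> a}) < (1 - e) * (p * real (card F))}
    \<le> exp (- (e\<^sup>2 * p / 2) * real (card F))"
proof -
  let ?\<mu> = "p * real (card F)"
  have "measure_pmf.prob (Pi_pmf A False (\<lambda>a. bernoulli_pmf (q a)))
      {\<omega>. real (card {a \<in> F. \<omega> a}) < (1 - e) * ?\<mu>}
    \<le> measure_pmf.prob (Pi_pmf A False (\<lambda>a. bernoulli_pmf (q a)))
      {\<omega>. - e * ((1 - e) * ?\<mu>) \<le> - e * real (card {a \<in> F. \<omega> a})}"
    using assms(6) by (intro measure_pmf.finite_measure_mono) (auto intro: mult_left_mono)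
  also have "\<dots> \<le> exp (?\<mu> * (exp (- e) - 1) - (- e * ((1 - e) * ?\<mu>)))"
    by (rule Pi_bernoulli_tail[OF assms(1-4)])
  also have "?\<mu> * (exp (- e) - 1) \<le> ?\<mu> * (- e + e\<^sup>2 / 2)"
    using exp_minus_le_quadratic[OF assms(6)] assms(5) by (intro mult_left_mono) auto
  then have "exp (?\<mu> * (exp (- e) - 1) - (- e * ((1 - e) * ?\<mu>))) \<le> exp (- (e\<^sup>2 * p / 2) * real (card F))"
    by (simp add: algebra_simps power2_eq_square)
  finally show ?thesis .
qed

text \<open>Take \<open>l = e/2\<close>; then
  \<open>e/2 + e^2/4 - e/2 * (1 + e) = - e^2/4\<close>.\<close>

lemma Pi_bernoulli_upper_tail:
  fixes p e :: real
  assumes "finite A" "F \<subseteq> A" "\<And>a. a \<in> A \<Longrightarrow> 0 \<le> q a \<and> q a \<le> 1" "\<And>a. a \<in> F \<Longrightarrow> q a = p"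
    and "0 \<le> p" "0 \<le> e" "e \<le> 1"
  shows "measure_pmf.prob (Pi_pmf A False (\<lambda>a. bernoulli_pmf (q a)))
      {\<omega>. real (card {a \<in> F. \<omega> a}) > (1 + e) * (p * real (card F))}
    \<le> exp (- (e\<^sup>2 * p / 4) * real (card F))"
proof -
  let ?\<mu> = "p * real (card F)"
  have "measure_pmf.prob (Pi_pmf A False (\<lambda>a. bernoulli_pmf (q a)))
      {\<omega>. real (card {a \<in> F. \<omega> a}) > (1 + e) * ?\<mu>}
    \<le> measure_pmf.prob (Pi_pmf A False (\<lambda>a. bernoulli_pmf (q a)))
      {\<omega>. e / 2 * ((1 + e) * ?\<mu>) \<le> e / 2 * real (card {a \<in> F. \<omega> a})}"
    using assms(6) by (intro measure_pmf.finite_measure_mono subsetI CollectI mult_left_mono) auto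
  also have "\<dots> \<le> exp (?\<mu> * (exp (e / 2) - 1) - e / 2 * ((1 + e) * ?\<mu>))"
    by (rule Pi_bernoulli_tail[OF assms(1-4)])
  also have "?\<mu> * (exp (e / 2) - 1) \<le> ?\<mu> * (e / 2 + (e / 2)\<^sup>2)"
    using exp_bound[of "e / 2"] assms(5-7) by (intro mult_left_mono) auto
  then have "exp (?\<mu> * (exp (e / 2) - 1) - e / 2 * ((1 + e) * ?\<mu>)) \<le> exp (- (e\<^sup>2 * p / 4) * real (card F))"
    by (simp add: algebra_simps power2_eq_square)
  finally show ?thesis .
qed

section \<open>The query algorithm\<close>

primrec bind_qalg :: "'a qalg \<Rightarrow> ('a \<Rightarrow> 'b qalg) \<Rightarrow> 'b qalg" where
  "bind_qalg (Return x) g = g x"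
| "bind_qalg (DegQ u k) g = DegQ u (\<lambda>d. bind_qalg (k d) g)"
| "bind_qalg (NbrQ u i k) g = NbrQ u i (\<lambda>a. bind_qalg (k a) g)"
| "bind_qalg (AdjQ u v k) g = AdjQ u v (\<lambda>a. bind_qalg (k a) g)"

lemma run_bind_qalg:
  "run adj (bind_qalg m g) =
    (fst (run adj (g (fst (run adj m)))), snd (run adj m) + snd (run adj (g (fst (run adj m)))))"
  by (induction m) (auto simp: Let_def case_prod_unfold)

primrec mapM_qalg :: "('a \<Rightarrow> 'b qalg) \<Rightarrow> 'a list \<Rightarrow> 'b list qalg" where
  "mapM_qalg g [] = Return []"
| "mapM_qalg g (x # xs) = bind_qalg (g x) (\<lambda>y. bind_qalg (mapM_qalg g xs) (\<lambda>ys. Return (y # ys)))"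

lemma run_mapM_qalg:
  assumes "\<And>x. x \<in> set xs \<Longrightarrow> run adj (g x) = (f x, 1)"
  shows "run adj (mapM_qalg g xs) = (map f xs, length xs)"
  using assms by (induction xs) (auto simp: run_bind_qalg)

definition degrees :: "nat \<Rightarrow> nat list qalg" where
  "degrees n = mapM_qalg (\<lambda>u. DegQ u Return) [0..<n]"

text \<open>Degrees are known and coins are tossed in advance, so slots that are not sampled cost no
  query. Each level \<open>j\<close> has coins of its own.\<close>

definition sampled_slots :: "nat \<Rightarrow> nat list \<Rightarrow> (nat \<times> nat \<times> nat \<Rightarrow> bool) \<Rightarrow> nat \<Rightarrow> (nat \<times> nat) list" where
  "sampled_slots n ds \<omega> j =
    filter (\<lambda>(u, i). i < ds ! u \<and> \<omega> (j, u, i)) (List.product [0..<n] [0..<n])"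

text \<open>Sampled slots lie below the degree, so with the true degrees the answer is never
  \<open>None\<close>.\<close>

definition sample_arcs :: "nat \<Rightarrow> nat list \<Rightarrow> (nat \<times> nat \<times> nat \<Rightarrow> bool) \<Rightarrow> nat \<Rightarrow> (nat \<times> nat) list qalg" where
  "sample_arcs n ds \<omega> j =
    mapM_qalg (\<lambda>(u, i). NbrQ u i (\<lambda>a. Return (u, the a))) (sampled_slots n ds \<omega> j)"

text \<open>The two arcs of an edge are sampled separately. Counting only arcs that leave
  \<open>S\<close> makes the expected count the rate times the cut size.\<close>

definition list_min_cut :: "nat \<Rightarrow> (nat \<times> nat) list \<Rightarrow> nat" where
  "list_min_cut n xs =
    Min ((\<lambda>S. length (filter (\<lambda>(u, v). u \<in> S \<and> v \<notin> S) xs)) ` proper_cuts {0..<n})"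

definition guess :: "nat \<Rightarrow> nat \<Rightarrow> real" where
  "guess n j = real n / 2 ^ j"

text \<open>\<open>768 = 8 * 96\<close>: a guess of at most \<open>8 k\<close> with rate
  \<open>p < 1\<close> has \<open>\<epsilon>^2 p k \<ge> 96 (1 + ln n)\<close>. The union bound over
  all cuts uses \<open>96 = 8 * 12\<close>, the upper tail \<open>96 = 16 * 6\<close>.\<close>

definition rate :: "nat \<Rightarrow> real \<Rightarrow> nat \<Rightarrow> real" where
  "rate n \<epsilon> j = min 1 (768 * (1 + ln (real n)) / (\<epsilon>\<^sup>2 * guess n j))"

text \<open>
  The value \<open>Return 0\<close> is never reached: the search starts with fuel \<open>n + 1\<close>, and at level \<open>n\<close> the
  rate is 1, where the estimate is accepted unconditionally.
\<close>

primrec search :: "nat \<Rightarrow> real \<Rightarrow> nat list \<Rightarrow> (nat \<times> nat \<times> nat \<Rightarrow> bool) \<Rightarrow> nat \<Rightarrow> nat \<Rightarrow> real qalg" where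
  "search n \<epsilon> ds \<omega> 0 j = Return 0"
| "search n \<epsilon> ds \<omega> (Suc f) j = bind_qalg (sample_arcs n ds \<omega> j) (\<lambda>xs.
    if rate n \<epsilon> j \<ge> 1 \<or> real (list_min_cut n xs) \<ge> rate n \<epsilon> j * guess n j / 2
    then Return (real (list_min_cut n xs) / rate n \<epsilon> j)
    else search n \<epsilon> ds \<omega> f (Suc j))"

definition min_cut_tree :: "nat \<Rightarrow> real \<Rightarrow> (nat \<times> nat \<times> nat \<Rightarrow> bool) \<Rightarrow> real qalg" where
  "min_cut_tree n \<epsilon> \<omega> = bind_qalg (degrees n) (\<lambda>ds. search n \<epsilon> ds \<omega> (Suc n) 0)"

text \<open>The index set holds all conceivable slots at all levels, so the distribution depends on
  \<open>n\<close> and \<open>\<epsilon>\<close> but not on the graph.\<close>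

definition coins :: "nat \<Rightarrow> real \<Rightarrow> (nat \<times> nat \<times> nat \<Rightarrow> bool) pmf" where
  "coins n \<epsilon> = Pi_pmf ({..n} \<times> {0..<n} \<times> {0..<n}) False (\<lambda>a. bernoulli_pmf (rate n \<epsilon> (fst a)))"

lemma guess_pos: "0 < n \<Longrightarrow> 0 < guess n j"
  by (simp add: guess_def)

lemma rate_pos: "0 < n \<Longrightarrow> 0 < \<epsilon> \<Longrightarrow> 0 < rate n \<epsilon> j"
  unfolding rate_def by (auto simp: guess_pos ln_ge_zero add_pos_nonneg intro!: divide_pos_pos mult_pos_pos)

lemma rate_le_1: "rate n \<epsilon> j \<le> 1"
  by (simp add: rate_def)

text \<open>This ensures termination: the guess \<open>n / 2 ^ n\<close> is at most 1, which forces
  the cap in \<open>rate\<close>.\<close>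

lemma rate_last:
  assumes "0 < n" "0 < \<epsilon>" "\<epsilon> < 1" shows "rate n \<epsilon> n = 1"
proof -
  have "real n \<le> 2 ^ n" using of_nat_less_two_power[of n, where 'a = real] by simp
  then have "guess n n \<le> 1" by (simp add: guess_def)
  moreover have "\<epsilon>\<^sup>2 \<le> 1" using assms by (simp add: power_le_one)
  ultimately have "\<epsilon>\<^sup>2 * guess n n \<le> 1 * 1"
    using guess_pos[OF assms(1), of n] by (intro mult_mono) auto
  also have "\<dots> \<le> 768 * (1 + ln (real n))" using assms by simp
  finally have "1 \<le> 768 * (1 + ln (real n)) / (\<epsilon>\<^sup>2 * guess n n)"
    using assms guess_pos[OF assms(1), of n] by (simp add: pos_le_divide_eq)
  then show ?thesis by (simp add: rate_def)
qed

text \<open>Hence the acceptance threshold is the same at all levels with rate below 1.\<close>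

lemma rate_less_1_mult_guess:
  assumes "0 < n" "0 < \<epsilon>" "rate n \<epsilon> j < 1"
  shows "rate n \<epsilon> j * guess n j = 768 * (1 + ln (real n)) / \<epsilon>\<^sup>2"
proof -
  have "rate n \<epsilon> j = 768 * (1 + ln (real n)) / (\<epsilon>\<^sup>2 * guess n j)"
    using assms(3) unfolding rate_def by (auto simp: min_def split: if_splits)
  then show ?thesis using guess_pos[OF assms(1), of j] assms by (simp add: field_simps)
qed

text \<open>\<open>exp 6 \<ge> 25\<close> covers the constant and \<open>n^6 \<ge> n^3\<close> the
  power. The bound is half of the failure budget of one level.\<close>

lemma exp_minus_le_inverse_cube:
  fixes x :: real
  assumes "1 \<le> n" "6 * (1 + ln (real n)) \<le> x"
  shows "exp (- x) \<le> 1 / (16 * real n ^ 3)"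
proof -
  have "(25 :: real) \<le> exp 6" using exp_lower_Taylor_quadratic[of "6 :: real"] by simp
  then have "16 * real n ^ 3 \<le> exp 6 * real n ^ 6"
    using assms(1) by (intro mult_mono power_increasing) auto
  also have "\<dots> = exp (6 * (1 + ln (real n)))"
    using assms(1) exp_of_nat_mult[of 6 "ln (real n)"]
    by (simp add: distrib_left exp_add)
  also have "\<dots> \<le> exp x" using assms(2) by simp
  finally show ?thesis using assms(1) by (simp add: exp_minus field_simps)
qed

section \<open>Adjacency-list slots as arcs of a symmetric multigraph\<close>

locale query_graph =
  fixes n :: nat and adj :: "nat \<Rightarrow> nat list" and \<epsilon> :: real
  assumes valid: "valid_graph n adj" and n2: "2 \<le> n" and mc_pos: "0 < min_cut n adj"
    and eps: "0 < \<epsilon>" "\<epsilon> < 1"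
begin

definition slots :: "(nat \<times> nat) set" where
  "slots = (SIGMA u:{0..<n}. {0..<length (adj u)})"

definition tgt :: "nat \<times> nat \<Rightarrow> nat" where
  "tgt e = adj (fst e) ! snd e"

definition cut_slots :: "nat set \<Rightarrow> (nat \<times> nat) set" where
  "cut_slots S = {e \<in> slots. fst e \<in> S \<and> tgt e \<notin> S}"

abbreviation cuts where "cuts \<equiv> proper_cuts {0..<n}"
abbreviation k where "k \<equiv> real (min_cut n adj)"
abbreviation p where "p \<equiv> rate n \<epsilon>"
abbreviation g where "g \<equiv> guess n"

definition sampled_cut :: "(nat \<times> nat \<times> nat \<Rightarrow> bool) \<Rightarrow> nat \<Rightarrow> nat set \<Rightarrow> nat" where
  "sampled_cut \<omega> j S = card {e \<in> cut_slots S. \<omega> (j, e)}"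

definition sampled_min_cut :: "(nat \<times> nat \<times> nat \<Rightarrow> bool) \<Rightarrow> nat \<Rightarrow> nat" where
  "sampled_min_cut \<omega> j = Min (sampled_cut \<omega> j ` cuts)"

definition num_sampled :: "(nat \<times> nat \<times> nat \<Rightarrow> bool) \<Rightarrow> nat \<Rightarrow> nat" where
  "num_sampled \<omega> j = card {e \<in> slots. \<omega> (j, e)}"

definition accepts :: "(nat \<times> nat \<times> nat \<Rightarrow> bool) \<Rightarrow> nat \<Rightarrow> bool" where
  "accepts \<omega> j \<longleftrightarrow> p j \<ge> 1 \<or> real (sampled_min_cut \<omega> j) \<ge> p j * g j / 2"

lemma deg_le: "length (adj u) \<le> n"
proof (cases "u < n")
  case True
  then have "distinct (adj u)" "set (adj u) \<subseteq> {0..<n}" using valid by (auto simp: valid_graph_def)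
  then show ?thesis using card_mono[of "{0..<n}" "set (adj u)"] by (simp add: distinct_card)
qed (use valid in \<open>simp add: valid_graph_def\<close>)

lemma slots_subset: "slots \<subseteq> {0..<n} \<times> {0..<n}"
  by (auto simp: slots_def intro: less_le_trans[OF _ deg_le])

lemma finite_slots [simp]: "finite slots"
  using slots_subset by (rule finite_subset) simp

lemma cut_slots_subset: "cut_slots S \<subseteq> slots"
  by (auto simp: cut_slots_def)

lemma tgt_less: "e \<in> slots \<Longrightarrow> tgt e < n"
  using valid by (force simp: slots_def tgt_def valid_graph_def)

lemma singleton_cut: "w < n \<Longrightarrow> {w} \<in> cuts"
proof -
  have "card {w} \<noteq> card {0..<n}" using n2 by simp
  then have "{w} \<noteq> {0..<n}" by metis
  then show "{w} \<in> cuts" if "w < n" using that unfolding proper_cuts_def by auto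
qed

lemma cuts_nonempty: "cuts \<noteq> {}"
  using singleton_cut[of 0] n2 by auto

text \<open>Adjacency lists have no repetitions, so slots can stand for the ordered pairs counted by
  \<open>cut_size\<close>.\<close>

lemma inj_on_arcs: "inj_on (\<lambda>e. (fst e, tgt e)) slots"
proof (rule inj_onI)
  fix a b assume ab: "a \<in> slots" "b \<in> slots" "(fst a, tgt a) = (fst b, tgt b)"
  then have "fst a < n" by (auto simp: slots_def)
  then have "distinct (adj (fst a))" using valid unfolding valid_graph_def by blast
  moreover have "snd a < length (adj (fst a))" "snd b < length (adj (fst a))"
      "adj (fst a) ! snd a = adj (fst a) ! snd b"
    using ab by (auto simp: slots_def tgt_def)
  ultimately have "snd a = snd b" using nth_eq_iff_index_eq by blast
  then show "a = b" using ab(3) by (simp add: prod_eq_iff)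
qed

lemma cut_size_eq: "S \<subseteq> {0..<n} \<Longrightarrow> cut_size adj S = card (cut_slots S)"
proof -
  assume S: "S \<subseteq> {0..<n}"
  have "bij_betw (\<lambda>e. (fst e, tgt e)) (cut_slots S) {(u, v). u \<in> S \<and> v \<notin> S \<and> v \<in> set (adj u)}"
    unfolding bij_betw_def
  proof
    show "inj_on (\<lambda>e. (fst e, tgt e)) (cut_slots S)"
      using inj_on_arcs cut_slots_subset by (rule inj_on_subset)
    show "(\<lambda>e. (fst e, tgt e)) ` cut_slots S = {(u, v). u \<in> S \<and> v \<notin> S \<and> v \<in> set (adj u)}"
    proof (intro equalityI subsetI)
      fix a assume "a \<in> {(u, v). u \<in> S \<and> v \<notin> S \<and> v \<in> set (adj u)}"
      then obtain u i where "a = (u, adj u ! i)" "u \<in> S" "adj u ! i \<notin> S" "i < length (adj u)"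
        by (auto simp: in_set_conv_nth)
      then show "a \<in> (\<lambda>e. (fst e, tgt e)) ` cut_slots S"
        using S by (intro image_eqI[of _ _ "(u, i)"]) (auto simp: cut_slots_def slots_def tgt_def)
    qed (auto simp: cut_slots_def slots_def tgt_def)
  qed
  then show ?thesis by (simp add: cut_size_def bij_betw_same_card)
qed

lemma min_cut_eq: "min_cut n adj = Min ((\<lambda>S. card (cut_slots S)) ` cuts)"
proof -
  have "{cut_size adj S |S. S \<subseteq> {0..<n} \<and> S \<noteq> {} \<and> S \<noteq> {0..<n}} = cut_size adj ` cuts"
    by (auto simp: proper_cuts_def)
  also have "\<dots> = (\<lambda>S. card (cut_slots S)) ` cuts"
    by (intro image_cong refl cut_size_eq) (auto simp: proper_cuts_def)
  finally show ?thesis by (simp add: min_cut_def)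
qed

lemma min_cut_le: "S \<in> cuts \<Longrightarrow> min_cut n adj \<le> card (cut_slots S)"
  unfolding min_cut_eq by simp

lemma min_cut_attained: obtains S where "S \<in> cuts" "card (cut_slots S) = min_cut n adj"
proof -
  have "min_cut n adj \<in> (\<lambda>S. card (cut_slots S)) ` cuts"
    unfolding min_cut_eq using cuts_nonempty by (intro Min_in) auto
  then show ?thesis using that by auto
qed

lemma multicut_slots: "multicut slots fst tgt S = card (cut_slots S)"
  by (simp add: multicut_def cut_slots_def)

text \<open>Adjacency is symmetric, so reversing arcs is the bijection. This supplies the symmetry
  hypothesis of \<open>sum_exp_multicut_le\<close>.\<close>

lemma cut_size_compl:
  assumes "S \<subseteq> {0..<n}" shows "cut_size adj ({0..<n} - S) = cut_size adj S"
proof -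
  have adj: "v < n \<and> u < n \<and> u \<in> set (adj v)" if "v \<in> set (adj u)" for u v
  proof -
    have "u < n" using that valid unfolding valid_graph_def by (metis empty_iff empty_set not_le)
    then have "set (adj u) \<subseteq> {0..<n}" "\<forall>v\<in>set (adj u). u \<in> set (adj v)"
      using valid unfolding valid_graph_def by blast+
    then show ?thesis using that \<open>u < n\<close> by auto
  qed
  have "bij_betw prod.swap {(u, v). u \<in> {0..<n} - S \<and> v \<notin> {0..<n} - S \<and> v \<in> set (adj u)}
      {(u, v). u \<in> S \<and> v \<notin> S \<and> v \<in> set (adj u)}"
    by (rule bij_betwI[where g = prod.swap]) (use assms adj in auto)
  then show ?thesis by (simp add: cut_size_def bij_betw_same_card)
qed

lemma card_cut_slots_compl: "S \<in> cuts \<Longrightarrow> card (cut_slots ({0..<n} - S)) = card (cut_slots S)"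
  using cut_size_compl[of S] cut_size_eq[of S] cut_size_eq[of "{0..<n} - S"]
  by (auto simp: proper_cuts_def)

text \<open>Every degree is at least \<open>k\<close>. This is what pays for the \<open>n\<close>
  degree queries.\<close>

lemma n_min_cut_le: "n * min_cut n adj \<le> card slots"
proof -
  have "n * min_cut n adj = (\<Sum>w\<in>{0..<n}. min_cut n adj)" by simp
  also have "\<dots> \<le> (\<Sum>w\<in>{0..<n}. multicut slots fst tgt {w})"
  proof (intro sum_mono)
    fix w assume "w \<in> {0..<n}"
    then have "{w} \<in> cuts" by (intro singleton_cut) auto
    then show "min_cut n adj \<le> multicut slots fst tgt {w}"
      unfolding multicut_slots by (rule min_cut_le)
  qed
  also have "\<dots> = card {e \<in> slots. fst e \<noteq> tgt e}"
    by (rule sum_multicut_singletons) (auto simp: slots_def)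
  also have "\<dots> \<le> card slots" by (intro card_mono) auto
  finally show ?thesis .
qed

lemma min_cut_le_n: "min_cut n adj \<le> n"
proof -
  have "{0} \<in> cuts" using n2 by (intro singleton_cut) auto
  then have "min_cut n adj \<le> card (cut_slots {0})" by (rule min_cut_le)
  also have "\<dots> \<le> card ({0::nat} \<times> {0..<n})"
    using slots_subset by (intro card_mono) (auto simp: cut_slots_def)
  finally show ?thesis by simp
qed

text \<open>An edge arises from at most its two orientations.\<close>

lemma card_slots_le: "card slots \<le> 2 * num_edges n adj"
proof -
  let ?A = "(\<lambda>e. (fst e, tgt e)) ` slots"
  let ?f = "\<lambda>(u, v). {u, v} :: nat set"
  have f: "?f ` ?A \<subseteq> edges n adj"
    by (force simp: edges_def slots_def tgt_def)
  have fin: "finite (edges n adj)"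
  proof (rule finite_subset)
    show "edges n adj \<subseteq> Pow {0..<n}" using valid by (auto simp: edges_def valid_graph_def subset_iff)
  qed simp
  have "card slots = card ?A" using inj_on_arcs by (simp add: card_image)
  also have "\<dots> = (\<Sum>d\<in>edges n adj. card {a \<in> ?A. ?f a = d})"
    using fin f by (subst card_eq_sum, subst sum.group[symmetric, where T = "edges n adj" and g = ?f]) auto
  also have "\<dots> \<le> (\<Sum>d\<in>edges n adj. 2)"
  proof (intro sum_mono)
    fix d assume "d \<in> edges n adj"
    then obtain x y where d: "d = {x, y}" by (auto simp: edges_def)
    have "card {a \<in> ?A. ?f a = d} \<le> card {(x, y), (y, x)}"
      by (intro card_mono) (auto simp: d doubleton_eq_iff)
    also have "\<dots> \<le> 2" by (cases "x = y") auto
    finally show "card {a \<in> ?A. ?f a = d} \<le> 2" .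
  qed
  finally show ?thesis by (simp add: num_edges_def)
qed


section \<open>Outcome and cost of a run for fixed coins\<close>

abbreviation ds where "ds \<equiv> map (\<lambda>u. length (adj u)) [0..<n]"

lemma run_degrees: "run adj (degrees n) = (ds, n)"
  unfolding degrees_def by (subst run_mapM_qalg[where f = "\<lambda>u. length (adj u)"]) auto

lemma sampled_slots_props:
  "distinct (sampled_slots n ds \<omega> j)" "set (sampled_slots n ds \<omega> j) = {e \<in> slots. \<omega> (j, e)}"
proof -
  show "distinct (sampled_slots n ds \<omega> j)"
    unfolding sampled_slots_def by (intro distinct_filter distinct_product) auto
  show "set (sampled_slots n ds \<omega> j) = {e \<in> slots. \<omega> (j, e)}"
    unfolding sampled_slots_def slots_def by (auto intro: less_le_trans[OF _ deg_le])
qed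

lemma run_sample_arcs:
  "run adj (sample_arcs n ds \<omega> j) =
    (map (\<lambda>e. (fst e, tgt e)) (sampled_slots n ds \<omega> j), num_sampled \<omega> j)"
proof -
  have "run adj (sample_arcs n ds \<omega> j) =
    (map (\<lambda>e. (fst e, tgt e)) (sampled_slots n ds \<omega> j), length (sampled_slots n ds \<omega> j))"
    unfolding sample_arcs_def
    by (rule run_mapM_qalg) (auto simp: sampled_slots_props slots_def tgt_def)
  then show ?thesis
    by (simp add: num_sampled_def distinct_card[symmetric] sampled_slots_props)
qed

lemma list_min_cut_sampled:
  "list_min_cut n (map (\<lambda>e. (fst e, tgt e)) (sampled_slots n ds \<omega> j)) = sampled_min_cut \<omega> j"
proof -
  have "length (filter (\<lambda>(u, v). u \<in> S \<and> v \<notin> S) (map (\<lambda>e. (fst e, tgt e)) (sampled_slots n ds \<omega> j))) =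
      sampled_cut \<omega> j S" for S
  proof -
    have "length (filter (\<lambda>(u, v). u \<in> S \<and> v \<notin> S) (map (\<lambda>e. (fst e, tgt e)) (sampled_slots n ds \<omega> j))) =
      length (filter (\<lambda>e. fst e \<in> S \<and> tgt e \<notin> S) (sampled_slots n ds \<omega> j))"
      by (simp add: filter_map o_def)
    also have "\<dots> = card (set (filter (\<lambda>e. fst e \<in> S \<and> tgt e \<notin> S) (sampled_slots n ds \<omega> j)))"
      by (intro distinct_card[symmetric] distinct_filter sampled_slots_props)
    also have "\<dots> = sampled_cut \<omega> j S"
      unfolding sampled_cut_def cut_slots_def set_filter sampled_slots_props
      by (intro arg_cong[where f = card]) auto
    finally show ?thesis .
  qed
  then show ?thesis unfolding list_min_cut_def sampled_min_cut_def by simp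
qed

text \<open>The witness is the first accepting level, and \<open>J < j + f\<close> ensures that the
  fuel reaches it. Its being first is not recorded, since accuracy will hold at every accepting
  level up to \<open>J\<close>.\<close>

lemma run_search:
  assumes "j \<le> J" "J < j + f" "accepts \<omega> J"
  shows "\<exists>i\<in>{j..J}. accepts \<omega> i \<and> run adj (search n \<epsilon> ds \<omega> f j) =
    (real (sampled_min_cut \<omega> i) / p i, \<Sum>i'\<in>{j..i}. num_sampled \<omega> i')"
  using assms
proof (induction f arbitrary: j)
  case (Suc f)
  show ?case
  proof (cases "accepts \<omega> j")
    case True
    then show ?thesis using Suc.prems
      by (intro bexI[of _ j])
        (auto simp: run_bind_qalg run_sample_arcs list_min_cut_sampled accepts_def)
  next
    case False
    then have "Suc j \<le> J" using Suc.prems by (cases "J = j") auto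
    then obtain i where i: "i \<in> {Suc j..J}" "accepts \<omega> i" "run adj (search n \<epsilon> ds \<omega> f (Suc j)) =
        (real (sampled_min_cut \<omega> i) / p i, \<Sum>i'\<in>{Suc j..i}. num_sampled \<omega> i')"
      using Suc.IH[of "Suc j"] Suc.prems by auto
    have "run adj (search n \<epsilon> ds \<omega> (Suc f) j) =
        (real (sampled_min_cut \<omega> i) / p i, \<Sum>i'\<in>{j..i}. num_sampled \<omega> i')"
      using False i(1) unfolding accepts_def
      by (simp add: run_bind_qalg run_sample_arcs list_min_cut_sampled i(3) sum.atLeast_Suc_atMost)
    then show ?thesis using i by (intro bexI[of _ i]) auto
  qed
qed simp

lemma run_min_cut_tree:
  assumes "J \<le> n" "accepts \<omega> J"
  shows "\<exists>i\<le>J. accepts \<omega> i \<and> run adj (min_cut_tree n \<epsilon> \<omega>) =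
    (real (sampled_min_cut \<omega> i) / p i, n + (\<Sum>i'\<le>i. num_sampled \<omega> i'))"
  using run_search[of 0 J "Suc n" \<omega>] assms
  by (auto simp: min_cut_tree_def run_bind_qalg run_degrees atLeast0AtMost simp del: search.simps)


section \<open>Success probability and query complexity\<close>

lemma coins_props:
  "finite ({..n} \<times> {0..<n} \<times> {0..<n})"
  "a \<in> {..n} \<times> {0..<n} \<times> {0..<n} \<Longrightarrow> 0 \<le> p (fst a) \<and> p (fst a) \<le> 1"
  using rate_pos[of n \<epsilon> "fst a"] rate_le_1[of n \<epsilon> "fst a"] n2 eps by auto

text \<open>\<open>Pair j\<close> turns slots into the coins of level \<open>j\<close>, all of rate
  \<open>p j\<close>, to which the Chernoff bounds apply.\<close>

lemma level_subset: "j \<le> n \<Longrightarrow> F \<subseteq> slots \<Longrightarrow> Pair j ` F \<subseteq> {..n} \<times> {0..<n} \<times> {0..<n}"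
  using slots_subset by fastforce

lemma card_Pair_image_Collect: "card {a \<in> Pair j ` F. \<omega> a} = card {e \<in> F. \<omega> (j, e)}"
proof -
  have "{a \<in> Pair j ` F. \<omega> a} = Pair j ` {e \<in> F. \<omega> (j, e)}" by auto
  then show ?thesis by (simp add: card_image inj_on_def)
qed

lemma card_Pair_image: "card (Pair j ` F) = card F"
  by (simp add: card_image inj_on_def)

lemma expectation_num_sampled:
  assumes "j \<le> n"
  shows "measure_pmf.expectation (coins n \<epsilon>) (\<lambda>\<omega>. real (num_sampled \<omega> j)) = p j * real (card slots)"
  unfolding num_sampled_def coins_def card_Pair_image_Collect[symmetric]
  by (subst expectation_Pi_bernoulli_card[OF coins_props(1) level_subset[OF assms order_refl], where p = "p j"])
    (use coins_props(2) in \<open>auto simp: card_Pair_image\<close>)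

lemma num_sampled_le: "num_sampled \<omega> j \<le> card slots"
  unfolding num_sampled_def by (intro card_mono) auto

text \<open>Rejection of large guesses is not demanded, only accuracy upon acceptance. If all levels
  down to a guess of at most \<open>k\<close> are good, the search stops by then with an accurate
  answer.\<close>

definition good :: "(nat \<times> nat \<times> nat \<Rightarrow> bool) \<Rightarrow> nat \<Rightarrow> bool" where
  "good \<omega> j \<longleftrightarrow>
    (accepts \<omega> j \<longrightarrow> (1 - \<epsilon>) * k \<le> real (sampled_min_cut \<omega> j) / p j \<and>
      real (sampled_min_cut \<omega> j) / p j \<le> (1 + \<epsilon>) * k) \<and>
    (g j \<le> k \<longrightarrow> accepts \<omega> j)"

lemma sampled_min_cut_le: "S \<in> cuts \<Longrightarrow> sampled_min_cut \<omega> j \<le> sampled_cut \<omega> j S"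
  unfolding sampled_min_cut_def by simp

lemma sampled_min_cut_attained:
  obtains S where "S \<in> cuts" "sampled_min_cut \<omega> j = sampled_cut \<omega> j S"
proof -
  have "sampled_min_cut \<omega> j \<in> sampled_cut \<omega> j ` cuts"
    unfolding sampled_min_cut_def using cuts_nonempty by (intro Min_in) auto
  then show ?thesis using that by auto
qed

lemma p_pos: "0 < p j"
  using rate_pos[of n \<epsilon> j] n2 eps by auto

text \<open>The minimum needs a lower bound on all cuts but an upper bound on a single one.
  Acceptance for \<open>g j \<le> k\<close> follows from
  \<open>1 - \<epsilon>/2 \<ge> 1/2\<close>.\<close>

lemma good_if_concentrated:
  assumes "\<And>S. S \<in> cuts \<Longrightarrow> (1 - \<epsilon> / 2) * (p j * real (card (cut_slots S))) \<le> real (sampled_cut \<omega> j S)"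
    and "S0 \<in> cuts" "card (cut_slots S0) = min_cut n adj"
    and "real (sampled_cut \<omega> j S0) \<le> (1 + \<epsilon> / 2) * (p j * k)"
  shows "good \<omega> j"
proof -
  let ?Y = "real (sampled_min_cut \<omega> j)"
  obtain S where S: "S \<in> cuts" "sampled_min_cut \<omega> j = sampled_cut \<omega> j S"
    using sampled_min_cut_attained .
  have "(1 - \<epsilon> / 2) * (p j * k) \<le> (1 - \<epsilon> / 2) * (p j * real (card (cut_slots S)))"
    using eps p_pos[of j] min_cut_le[OF S(1)] by (intro mult_left_mono) auto
  also have "\<dots> \<le> ?Y" using assms(1)[OF S(1)] S(2) by simp
  finally have lo: "(1 - \<epsilon> / 2) * k * p j \<le> ?Y" by (simp add: mult_ac)
  have hi: "?Y \<le> (1 + \<epsilon> / 2) * k * p j"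
    using sampled_min_cut_le[OF assms(2), of \<omega> j] assms(4) by (simp add: mult_ac)
  have "(1 - \<epsilon>) * k \<le> (1 - \<epsilon> / 2) * k" using eps by (intro mult_right_mono) auto
  also have "\<dots> \<le> ?Y / p j" using lo p_pos[of j] by (simp add: pos_le_divide_eq)
  finally have A: "(1 - \<epsilon>) * k \<le> ?Y / p j" .
  have "?Y / p j \<le> (1 + \<epsilon> / 2) * k" using hi p_pos[of j] by (simp add: pos_divide_le_eq)
  also have "\<dots> \<le> (1 + \<epsilon>) * k" using eps by (intro mult_right_mono) auto
  finally have B: "?Y / p j \<le> (1 + \<epsilon>) * k" .
  have C: "accepts \<omega> j" if "g j \<le> k"
  proof -
    have "p j * g j / 2 \<le> 1 / 2 * k * p j" using that p_pos[of j] by simp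
    also have "\<dots> \<le> (1 - \<epsilon> / 2) * k * p j"
      using eps p_pos[of j] by (intro mult_right_mono) auto
    finally show ?thesis using lo by (auto simp: accepts_def)
  qed
  show ?thesis using A B C by (simp add: good_def)
qed

section \<open>Failure probability of a single guess\<close>

lemma prob_bad_full_rate:
  assumes "j \<le> n" "p j = 1"
  shows "measure_pmf.prob (coins n \<epsilon>) {\<omega>. \<not> good \<omega> j} = 0"
proof -
  have "good \<omega> j" if "\<omega> \<in> set_pmf (coins n \<epsilon>)" for \<omega>
  proof -
    \<comment> \<open>At rate 1 every slot is sampled with certainty, so sampled cuts are the true
      cuts.\<close>
    have all: "\<omega> (j, e)" if "e \<in> slots" for e
    proof -
      have "(j, e) \<in> {..n} \<times> {0..<n} \<times> {0..<n}" using that assms(1) slots_subset by auto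
      then have "\<omega> (j, e) \<in> set_pmf (bernoulli_pmf (p j))"
        using \<open>\<omega> \<in> set_pmf (coins n \<epsilon>)\<close> unfolding coins_def
        by (auto simp: set_Pi_pmf PiE_dflt_def)
      then show ?thesis using assms(2) by (cases "\<omega> (j, e)") (auto simp: set_pmf_iff)
    qed
    have X: "sampled_cut \<omega> j S = card (cut_slots S)" for S
      unfolding sampled_cut_def using all cut_slots_subset
      by (intro arg_cong[where f = card]) blast
    obtain S0 where S0: "S0 \<in> cuts" "card (cut_slots S0) = min_cut n adj"
      using min_cut_attained .
    show ?thesis
      by (rule good_if_concentrated[OF _ S0]) (use eps S0 in \<open>auto simp: X assms(2) distrib_right left_diff_distrib\<close>)
  qed
  then show ?thesis by (subst measure_pmf_zero_iff) auto
qed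

text \<open>As \<open>g j > k\<close>, a bad level must accept. Then a minimum cut, of expected
  sample size at most \<open>p j * g j / 8\<close>, reaches four times this value.\<close>

lemma prob_bad_large_guess:
  assumes "j \<le> n" "p j < 1" "8 * k \<le> g j"
  shows "measure_pmf.prob (coins n \<epsilon>) {\<omega>. \<not> good \<omega> j} \<le> 1 / (8 * real n ^ 3)"
proof -
  obtain S0 where S0: "S0 \<in> cuts" "card (cut_slots S0) = min_cut n adj"
    using min_cut_attained .
  have ln0: "0 \<le> ln (real n)" using n2 by simp
  have sub: "{\<omega>. \<not> good \<omega> j} \<subseteq> {\<omega>. p j * g j / 2 \<le> 1 * real (card {a \<in> Pair j ` cut_slots S0. \<omega> a})}"
  proof (intro subsetI CollectI)
    fix \<omega> assume "\<omega> \<in> {\<omega>. \<not> good \<omega> j}"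
    moreover have "\<not> g j \<le> k" using assms(3) mc_pos by linarith
    ultimately have "accepts \<omega> j" by (auto simp: good_def)
    then show "p j * g j / 2 \<le> 1 * real (card {a \<in> Pair j ` cut_slots S0. \<omega> a})"
      using assms(2) sampled_min_cut_le[OF S0(1), of \<omega> j]
      by (simp add: accepts_def card_Pair_image_Collect sampled_cut_def)
  qed
  \<comment> \<open>Tail bound with \<open>l = 1\<close>: since \<open>exp 1 \<le> 3\<close>, the
    moment term is at most half of the threshold \<open>p j * g j / 2\<close>.\<close>
  have "p j * k * (exp 1 - 1) \<le> p j * k * 2"
    using p_pos[of j] exp_le by (intro mult_left_mono) auto
  also have "\<dots> \<le> p j * (g j / 4)" using assms(3) p_pos[of j]
    by (simp only: mult.assoc) (intro mult_left_mono, auto)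
  finally have e: "p j * k * (exp 1 - 1) - p j * g j / 2 \<le> - (p j * g j / 4)" by simp
  have "p j * g j = 768 * (1 + ln (real n)) / \<epsilon>\<^sup>2"
    using n2 by (intro rate_less_1_mult_guess[OF _ eps(1) assms(2)]) simp
  also have "768 * (1 + ln (real n)) / \<epsilon>\<^sup>2 \<ge> 768 * (1 + ln (real n))"
    using eps ln0 by (simp add: pos_le_divide_eq power_le_one mult_left_le)
  finally have scale: "768 * (1 + ln (real n)) \<le> p j * g j" .
  have "6 * x \<le> y / 4" if "768 * x \<le> y" "0 \<le> x" for x y :: real
    using that by linarith
  from this[OF scale] ln0 have f: "6 * (1 + ln (real n)) \<le> p j * g j / 4" by simp
  have "measure_pmf.prob (coins n \<epsilon>) {\<omega>. \<not> good \<omega> j} \<le>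
      exp (p j * real (card (Pair j ` cut_slots S0)) * (exp 1 - 1) - p j * g j / 2)"
    using sub unfolding coins_def
    by (intro order_trans[OF measure_pmf.finite_measure_mono Pi_bernoulli_tail[OF coins_props(1)
          level_subset[OF assms(1) cut_slots_subset]]])
      (use coins_props(2) in auto)
  also have "\<dots> \<le> exp (- (p j * g j / 4))" using e S0(2) by (simp add: card_Pair_image)
  also have "\<dots> \<le> 1 / (16 * real n ^ 3)" using n2 f by (intro exp_minus_le_inverse_cube) auto
  also have "\<dots> \<le> 1 / (8 * real n ^ 3)" using n2 by (intro divide_left_mono) auto
  finally show ?thesis .
qed

text \<open>Failure means that some cut is sampled too low or the chosen minimum cut too high. The
  first event is summed over all cuts by \<open>sum_exp_multicut_le\<close>.\<close>

lemma prob_bad_small_guess: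
  assumes "j \<le> n" "p j < 1" "g j \<le> 8 * k"
  shows "measure_pmf.prob (coins n \<epsilon>) {\<omega>. \<not> good \<omega> j} \<le> 1 / (8 * real n ^ 3)"
proof -
  obtain S0 where S0: "S0 \<in> cuts" "card (cut_slots S0) = min_cut n adj"
    using min_cut_attained .
  let ?P = "measure_pmf.prob (coins n \<epsilon>)"
  let ?low = "\<lambda>S. {\<omega>. real (sampled_cut \<omega> j S) < (1 - \<epsilon> / 2) * (p j * real (card (cut_slots S)))}"
  let ?up = "{\<omega>. real (sampled_cut \<omega> j S0) > (1 + \<epsilon> / 2) * (p j * k)}"
  have ln0: "0 \<le> ln (real n)" using n2 by simp
  have k0: "0 < k" using mc_pos by simp
  have "\<epsilon>\<^sup>2 * p j * g j = 768 * (1 + ln (real n))"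
    using rate_less_1_mult_guess[OF _ eps(1) assms(2)] n2 eps by (simp add: field_simps)
  moreover have "\<epsilon>\<^sup>2 * p j * g j \<le> \<epsilon>\<^sup>2 * p j * (8 * k)"
    using assms(3) p_pos[of j] by (intro mult_left_mono) auto
  ultimately have pk: "96 * (1 + ln (real n)) \<le> \<epsilon>\<^sup>2 * p j * k" by simp

  have low: "?P (?low S) \<le> exp (- (4 / k * ln (4 * real n ^ 2 * real n) * real (card (cut_slots S))))" for S
  proof -
    have "?P (?low S) \<le> exp (- ((\<epsilon> / 2)\<^sup>2 * p j / 2) * real (card (Pair j ` cut_slots S)))"
      unfolding coins_def sampled_cut_def card_Pair_image_Collect[symmetric] card_Pair_image[of j "cut_slots S", symmetric]
      using eps p_pos[of j] coins_props(2)
      by (intro Pi_bernoulli_lower_tail[OF coins_props(1) level_subset[OF assms(1) cut_slots_subset]])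
        (auto simp: less_imp_le)
    also have "\<dots> \<le> exp (- (4 / k * ln (4 * real n ^ 2 * real n)) * real (card (cut_slots S)))"
    proof -
      \<comment> \<open>Thus \<open>4 * ln (4 n^3) \<le> 12 (1 + ln n)\<close>, an eighth of the
        bound in \<open>pk\<close>.\<close>
      have "ln (4 :: real) \<le> 3" using ln_le_minus_one[of "4 :: real"] by simp
      then have "ln (4 * real n ^ 2 * real n) \<le> 3 * (1 + ln (real n))"
        using n2 by (simp add: ln_mult_pos ln_realpow)
      then have "4 * ln (4 * real n ^ 2 * real n) \<le> \<epsilon>\<^sup>2 * p j * k / 8" using pk by linarith
      then have "4 / k * ln (4 * real n ^ 2 * real n) \<le> (\<epsilon> / 2)\<^sup>2 * p j / 2"
        using k0 by (simp add: power_divide pos_divide_le_eq mult_ac)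
      then show ?thesis unfolding card_Pair_image exp_le_cancel_iff
        by (intro mult_right_mono) auto
    qed
    finally show ?thesis by simp
  qed
  have "?P (\<Union>S\<in>cuts. ?low S) \<le> (\<Sum>S\<in>cuts. ?P (?low S))"
    by (intro measure_pmf.finite_measure_subadditive_finite) auto
  also have "\<dots> \<le> (\<Sum>S\<in>cuts. exp (- (4 / k * ln (4 * real n ^ 2 * real n) * real (card (cut_slots S)))))"
    by (intro sum_mono low)
  \<comment> \<open>\<open>B = 4 n^2\<close> is chosen so that \<open>n / B^2\<close> is half of the
    failure budget.\<close>
  also have "\<dots> \<le> real n / (4 * real n ^ 2)\<^sup>2"
  proof -
    have "1 \<le> real n ^ 2" using n2 by (intro one_le_power) simp
    then have B: "1 \<le> 4 * real n ^ 2" by linarith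
    have "fst ` slots \<subseteq> {0..<n}" "tgt ` slots \<subseteq> {0..<n}"
      using slots_subset tgt_less by auto
    then show ?thesis
      using sum_exp_multicut_le[OF finite_slots finite_atLeastLessThan _ _ k0 B, of fst 0 n tgt]
        min_cut_le card_cut_slots_compl
      by (simp add: multicut_slots)
  qed
  also have "\<dots> = 1 / (16 * real n ^ 3)"
    using n2 by (simp add: field_simps power2_eq_square power3_eq_cube)
  finally have L: "?P (\<Union>S\<in>cuts. ?low S) \<le> 1 / (16 * real n ^ 3)" .

  have "?P ?up \<le> exp (- ((\<epsilon> / 2)\<^sup>2 * p j / 4) * real (card (Pair j ` cut_slots S0)))"
    unfolding coins_def sampled_cut_def card_Pair_image_Collect[symmetric] S0(2)[symmetric]
      card_Pair_image[of j "cut_slots S0", symmetric]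
    using eps p_pos[of j] coins_props(2)
    by (intro Pi_bernoulli_upper_tail[OF coins_props(1) level_subset[OF assms(1) cut_slots_subset]])
      (auto simp: less_imp_le)
  also have "\<dots> = exp (- (\<epsilon>\<^sup>2 * p j * k / 16))"
    by (simp add: card_Pair_image S0(2) power_divide)
  also have "\<dots> \<le> 1 / (16 * real n ^ 3)"
    using pk n2 by (intro exp_minus_le_inverse_cube) auto
  finally have U: "?P ?up \<le> 1 / (16 * real n ^ 3)" .

  have "{\<omega>. \<not> good \<omega> j} \<subseteq> (\<Union>S\<in>cuts. ?low S) \<union> ?up"
  proof (intro subsetI)
    fix \<omega> assume "\<omega> \<in> {\<omega>. \<not> good \<omega> j}"
    then show "\<omega> \<in> (\<Union>S\<in>cuts. ?low S) \<union> ?up"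
      using good_if_concentrated[OF _ S0, of j \<omega>]
      by (auto simp: not_less not_le) (meson not_le)
  qed
  then have "?P {\<omega>. \<not> good \<omega> j} \<le> ?P ((\<Union>S\<in>cuts. ?low S) \<union> ?up)"
    by (intro measure_pmf.finite_measure_mono) auto
  also have "\<dots> \<le> ?P (\<Union>S\<in>cuts. ?low S) + ?P ?up"
    by (intro measure_Un_le) auto
  also have "\<dots> \<le> 1 / (16 * real n ^ 3) + 1 / (16 * real n ^ 3)" using L U by (rule add_mono)
  finally show ?thesis by simp
qed

lemma prob_bad: "j \<le> n \<Longrightarrow> measure_pmf.prob (coins n \<epsilon>) {\<omega>. \<not> good \<omega> j} \<le> 1 / (8 * real n ^ 3)"
  using prob_bad_full_rate[of j] prob_bad_large_guess[of j] prob_bad_small_guess[of j] rate_le_1[of n \<epsilon> j]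
  by (cases "p j = 1"; cases "8 * k \<le> g j") auto

section \<open>The last guess and the expected cost\<close>

definition last_level :: nat where
  "last_level = (LEAST j. g j \<le> k)"

lemma guess_n_le: "g n \<le> k"
proof -
  have "real n \<le> 2 ^ n" using of_nat_less_two_power[of n, where 'a = real] by simp
  then have "g n \<le> 1" by (simp add: guess_def)
  also have "1 \<le> k" using mc_pos by simp
  finally show ?thesis .
qed

lemma last_level_props: "last_level \<le> n" "g last_level \<le> k"
  unfolding last_level_def using guess_n_le by (auto intro: Least_le LeastI)

text \<open>The last guess is at least \<open>k/2\<close>: by minimality the guess before it exceeds
  \<open>k\<close>, and if there is none, the last guess is \<open>n \<ge> k\<close>.\<close>

lemma last_level_upper: "2 ^ last_level / real n \<le> 2 / k"
proof (cases last_level)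
  case 0
  have "1 / real n \<le> 1 / k" using mc_pos min_cut_le_n by (intro divide_left_mono) auto
  then show ?thesis using 0 divide_right_mono[of 1 2 k] by simp
next
  case (Suc i)
  then have "\<not> g i \<le> k" unfolding last_level_def by (metis lessI not_less_Least)
  then have "k * 2 ^ i \<le> real n" by (simp add: guess_def pos_divide_le_eq)
  then show ?thesis using Suc mc_pos n2 by (simp add: field_simps)
qed

text \<open>Rates at most double from level to level in the uncapped formula. The geometric sum
  costs one factor 2 and \<open>last_level_upper\<close> the other.\<close>

lemma sum_rates_le: "(\<Sum>j\<le>last_level. p j) \<le> 4 * 768 * (1 + ln (real n)) / (\<epsilon>\<^sup>2 * k)"
proof -
  let ?L = "768 * (1 + ln (real n)) / \<epsilon>\<^sup>2"
  have L0: "0 \<le> ?L" using n2 by simp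
  have "(\<Sum>j\<le>last_level. p j) \<le> (\<Sum>j\<le>last_level. ?L * (2 ^ j / real n))"
    by (intro sum_mono) (simp add: rate_def guess_def)
  also have "\<dots> = ?L * ((2 ^ Suc last_level - 1) / real n)"
    unfolding sum_distrib_left[symmetric] sum_divide_distrib[symmetric]
    by (simp add: lessThan_Suc_atMost[symmetric] geometric_sum del: sum.lessThan_Suc)
  also have "\<dots> \<le> ?L * (4 / k)"
  proof (intro mult_left_mono L0)
    have "(2 ^ Suc last_level - 1) / real n \<le> 2 * (2 ^ last_level / real n)"
      by (simp add: divide_right_mono)
    also have "\<dots> \<le> 4 / k" using last_level_upper by simp
    finally show "(2 ^ Suc last_level - 1) / real n \<le> 4 / k" .
  qed
  finally show ?thesis by simp
qed

definition bad_run :: "(nat \<times> nat \<times> nat \<Rightarrow> bool) set" where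
  "bad_run = (\<Union>j\<in>{..last_level}. {\<omega>. \<not> good \<omega> j})"

text \<open>There are at most \<open>n + 1 \<le> 2n\<close> levels.\<close>

lemma prob_bad_run: "measure_pmf.prob (coins n \<epsilon>) bad_run \<le> 1 / (4 * real n ^ 2)"
proof -
  have "measure_pmf.prob (coins n \<epsilon>) bad_run \<le>
      (\<Sum>j\<le>last_level. measure_pmf.prob (coins n \<epsilon>) {\<omega>. \<not> good \<omega> j})"
    unfolding bad_run_def by (intro measure_pmf.finite_measure_subadditive_finite) auto
  also have "\<dots> \<le> (\<Sum>j\<le>last_level. 1 / (8 * real n ^ 3))"
    using last_level_props(1) by (intro sum_mono prob_bad) auto
  also have "\<dots> = real (Suc last_level) * (1 / (8 * real n ^ 3))" by simp
  also have "\<dots> \<le> (2 * real n) * (1 / (8 * real n ^ 3))"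
    using last_level_props(1) n2 by (intro mult_right_mono) auto
  also have "\<dots> = 1 / (4 * real n ^ 2)"
    using n2 by (simp add: field_simps power2_eq_square power3_eq_cube)
  finally show ?thesis .
qed

lemma run_good:
  assumes "\<omega> \<notin> bad_run"
  shows "(1 - \<epsilon>) * k \<le> fst (run adj (min_cut_tree n \<epsilon> \<omega>))"
    "fst (run adj (min_cut_tree n \<epsilon> \<omega>)) \<le> (1 + \<epsilon>) * k"
    "snd (run adj (min_cut_tree n \<epsilon> \<omega>)) \<le> n + (\<Sum>j\<le>last_level. num_sampled \<omega> j)"
proof -
  have good: "good \<omega> j" if "j \<le> last_level" for j
    using assms that by (auto simp: bad_run_def)
  then have "accepts \<omega> last_level" using last_level_props(2) by (auto simp: good_def)
  then obtain i where i: "i \<le> last_level" "accepts \<omega> i" "run adj (min_cut_tree n \<epsilon> \<omega>) =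
      (real (sampled_min_cut \<omega> i) / p i, n + (\<Sum>i'\<le>i. num_sampled \<omega> i'))"
    using run_min_cut_tree[OF last_level_props(1)] by blast
  show "(1 - \<epsilon>) * k \<le> fst (run adj (min_cut_tree n \<epsilon> \<omega>))"
    "fst (run adj (min_cut_tree n \<epsilon> \<omega>)) \<le> (1 + \<epsilon>) * k"
    using good[OF i(1)] i(2) by (auto simp: i(3) good_def)
  show "snd (run adj (min_cut_tree n \<epsilon> \<omega>)) \<le> n + (\<Sum>j\<le>last_level. num_sampled \<omega> j)"
    unfolding i(3) using i(1) by (auto intro!: sum_mono2)
qed

text \<open>Level \<open>n\<close> accepts whatever the coins are, which gives a worst-case cost for
  the bad runs.\<close>

lemma run_queries_le:
  "snd (run adj (min_cut_tree n \<epsilon> \<omega>)) \<le> n + (n + 1) * card slots"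
proof -
  have "accepts \<omega> n" using rate_last[of n \<epsilon>] n2 eps by (simp add: accepts_def)
  then obtain i where i: "i \<le> n" "run adj (min_cut_tree n \<epsilon> \<omega>) =
      (real (sampled_min_cut \<omega> i) / p i, n + (\<Sum>i'\<le>i. num_sampled \<omega> i'))"
    using run_min_cut_tree[of n \<omega>] by blast
  have "(\<Sum>i'\<le>i. num_sampled \<omega> i') \<le> (\<Sum>i'\<le>i. card slots)" by (intro sum_mono num_sampled_le)
  also have "\<dots> \<le> (n + 1) * card slots" using i(1) by simp
  finally show ?thesis by (simp add: i(2))
qed

lemma success_prob_min_cut_tree:
  "2 / 3 \<le> success_prob (map_pmf (min_cut_tree n \<epsilon>) (coins n \<epsilon>)) adj
    (\<lambda>x. (1 - \<epsilon>) * k \<le> x \<and> x \<le> (1 + \<epsilon>) * k)"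
proof -
  have "1 \<le> real n ^ 2" using n2 by (intro one_le_power) simp
  then have "3 \<le> 4 * real n ^ 2" by linarith
  then have "1 / (4 * real n ^ 2) \<le> 1 / 3" using n2 by (intro divide_left_mono) auto
  then have "2 / 3 \<le> 1 - measure_pmf.prob (coins n \<epsilon>) bad_run" using prob_bad_run by linarith
  also have "\<dots> = measure_pmf.prob (coins n \<epsilon>) (- bad_run)"
    using measure_pmf.prob_compl[of bad_run "coins n \<epsilon>"] by (simp add: Compl_eq_Diff_UNIV)
  also have "\<dots> \<le> success_prob (map_pmf (min_cut_tree n \<epsilon>) (coins n \<epsilon>)) adj
      (\<lambda>x. (1 - \<epsilon>) * k \<le> x \<and> x \<le> (1 + \<epsilon>) * k)"
    unfolding success_prob_def measure_map_pmf
    by (intro measure_pmf.finite_measure_mono) (auto simp: run_good)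
  finally show ?thesis .
qed

lemma expected_queries_min_cut_tree:
  "expected_queries (map_pmf (min_cut_tree n \<epsilon>) (coins n \<epsilon>)) adj \<le>
    ennreal (6147 * (real (num_edges n adj) / (\<epsilon>\<^sup>2 * k)) * (1 + ln (real n / \<epsilon>)))"
proof -
  let ?M = "coins n \<epsilon>" and ?s = "real (card slots)"
  \<comment> \<open>The worst-case cost is charged on \<open>bad_run\<close> only, so no
    independence between the stopping level and the samples is needed.\<close>
  let ?h = "\<lambda>\<omega>. real n + (\<Sum>j\<le>last_level. real (num_sampled \<omega> j)) + (real n + 1) * ?s * indicator bad_run \<omega>"
  have int1: "integrable ?M (\<lambda>\<omega>. real (num_sampled \<omega> j))" for j
    by (rule measure_pmf.integrable_const_bound[where B = ?s]) (auto simp: num_sampled_le)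
  have int2: "integrable ?M (indicator bad_run :: _ \<Rightarrow> real)"
    by (rule measure_pmf.integrable_const_bound[where B = 1]) (auto simp: indicator_def)
  have pointwise: "real (snd (run adj (min_cut_tree n \<epsilon> \<omega>))) \<le> ?h \<omega>" for \<omega>
  proof (cases "\<omega> \<in> bad_run")
    case True
    have "real (snd (run adj (min_cut_tree n \<epsilon> \<omega>))) \<le> real (n + (n + 1) * card slots)"
      using run_queries_le by (simp only: of_nat_le_iff)
    also have "\<dots> \<le> ?h \<omega>" using True by (simp add: sum_nonneg distrib_right)
    finally show ?thesis .
  next
    case False
    have "real (snd (run adj (min_cut_tree n \<epsilon> \<omega>))) \<le> real (n + (\<Sum>j\<le>last_level. num_sampled \<omega> j))"
      using run_good(3)[OF False] by (simp only: of_nat_le_iff)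
    then show ?thesis using False by simp
  qed
  have m: "?s \<le> 2 * real (num_edges n adj)"
    using card_slots_le by (metis of_nat_le_iff of_nat_mult of_nat_numeral)
  have k0: "0 < k" using mc_pos by simp
  have nk: "real n * k \<le> ?s" using n_min_cut_le by (metis of_nat_le_iff of_nat_mult)
  have e2: "\<epsilon>\<^sup>2 \<le> 1" "0 < \<epsilon>\<^sup>2" using eps by (auto simp: power_le_one)
  define Q where "Q = ?s / (\<epsilon>\<^sup>2 * k)"
  have Q: "?s / k \<le> Q"
    unfolding Q_def using e2 k0 by (intro divide_left_mono mult_left_le_one_le) (auto simp: mult_le_cancel_right2)
  have ln0: "0 \<le> ln (real n)" using n2 by simp
  have "expected_queries (map_pmf (min_cut_tree n \<epsilon>) ?M) adj =
      (\<integral>\<^sup>+ \<omega>. ennreal (real (snd (run adj (min_cut_tree n \<epsilon> \<omega>)))) \<partial>measure_pmf ?M)"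
    unfolding expected_queries_def by simp
  also have "\<dots> \<le> (\<integral>\<^sup>+ \<omega>. ennreal (?h \<omega>) \<partial>measure_pmf ?M)"
    by (intro nn_integral_mono ennreal_leI pointwise)
  also have "\<dots> = ennreal (measure_pmf.expectation ?M ?h)"
  proof (rule nn_integral_eq_integral)
    show "integrable ?M ?h"
      by (intro Bochner_Integration.integrable_add Bochner_Integration.integrable_sum
          integrable_mult_right int1 int2) auto
  qed (auto intro!: sum_nonneg add_nonneg_nonneg)
  also have "measure_pmf.expectation ?M ?h =
      real n + (\<Sum>j\<le>last_level. p j * ?s) + (real n + 1) * ?s * measure_pmf.prob ?M bad_run"
    using int1 int2 last_level_props(1)
    by (simp add: expectation_num_sampled)
  also have "\<dots> \<le> Q + 4 * 768 * (1 + ln (real n)) * Q + Q / 2"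
  proof (intro add_mono)
    show "real n \<le> Q" using nk k0 by (intro order_trans[OF _ Q]) (simp add: pos_le_divide_eq)
    show "(\<Sum>j\<le>last_level. p j * ?s) \<le> 4 * 768 * (1 + ln (real n)) * Q"
      using mult_right_mono[OF sum_rates_le, of ?s] by (simp add: sum_distrib_right Q_def)
    \<comment> \<open>The probability \<open>1 / (4 n^2)\<close> reduces the worst-case cost to
      \<open>?s / (2n)\<close>, and \<open>k \<le> n\<close>.\<close>
    have "(real n + 1) * ?s * measure_pmf.prob ?M bad_run \<le> (2 * real n) * ?s * (1 / (4 * real n ^ 2))"
      using prob_bad_run n2 by (intro mult_mono) auto
    also have "\<dots> = ?s / real n / 2" using n2 by (simp add: field_simps power2_eq_square)
    also have "\<dots> \<le> ?s / k / 2"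
      using min_cut_le_n k0 by (intro divide_right_mono divide_left_mono) auto
    finally show "(real n + 1) * ?s * measure_pmf.prob ?M bad_run \<le> Q / 2" using Q by simp
  qed
  \<comment> \<open>\<open>1 + 4 * 768 + 1/2 = 6147/2\<close>; the bound of two slots per edge then
    doubles it.\<close>
  also have "\<dots> \<le> 6147 / 2 * (1 + ln (real n)) * Q"
  proof -
    have "0 \<le> Q" unfolding Q_def using k0 by simp
    then have "0 \<le> ln (real n) * Q" using ln0 by simp
    then show ?thesis by (simp add: algebra_simps)
  qed
  also have "\<dots> \<le> 6147 / 2 * (1 + ln (real n / \<epsilon>)) * (2 * real (num_edges n adj) / (\<epsilon>\<^sup>2 * k))"
  proof (intro mult_mono)
    have "real n * \<epsilon> \<le> real n" using eps by (simp add: mult_left_le)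
    then show "1 + ln (real n) \<le> 1 + ln (real n / \<epsilon>)"
      using n2 eps by (simp add: pos_le_divide_eq)
    then show "0 \<le> 6147 / 2 * (1 + ln (real n / \<epsilon>))" using ln0 by simp
    show "Q \<le> 2 * real (num_edges n adj) / (\<epsilon>\<^sup>2 * k)"
      unfolding Q_def using m k0 by (intro divide_right_mono) auto
    show "0 \<le> Q" unfolding Q_def using k0 by simp
  qed (use ln0 in auto)
  finally show ?thesis by (simp add: ennreal_leI mult_ac)
qed

end

theorem theorem5p7:
  shows "\<exists>(A :: nat \<Rightarrow> real \<Rightarrow> real qalg pmf) (C :: real) (c :: nat).
    \<forall>n adj (\<epsilon> :: real).
      valid_graph n adj \<and> 2 \<le> n \<and> 0 < min_cut n adj \<and> 0 < \<epsilon> \<and> \<epsilon> < 1 \<longrightarrow>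
      success_prob (A n \<epsilon>) adj
        (\<lambda>x. (1 - \<epsilon>) * real (min_cut n adj) \<le> x \<and> x \<le> (1 + \<epsilon>) * real (min_cut n adj))
        \<ge> 2 / 3 \<and>
      expected_queries (A n \<epsilon>) adj \<le>
        ennreal (C * (real (num_edges n adj) / (\<epsilon>\<^sup>2 * real (min_cut n adj)))
                   * (1 + ln (real n / \<epsilon>)) ^ c)"
proof (intro exI allI impI)
  fix n adj and \<epsilon> :: real
  assume "valid_graph n adj \<and> 2 \<le> n \<and> 0 < min_cut n adj \<and> 0 < \<epsilon> \<and> \<epsilon> < 1"
  then interpret query_graph n adj \<epsilon> by unfold_locales auto
  show "success_prob (map_pmf (min_cut_tree n \<epsilon>) (coins n \<epsilon>)) adj
        (\<lambda>x. (1 - \<epsilon>) * real (min_cut n adj) \<le> x \<and> x \<le> (1 + \<epsilon>) * real (min_cut n adj))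
        \<ge> 2 / 3 \<and>
      expected_queries (map_pmf (min_cut_tree n \<epsilon>) (coins n \<epsilon>)) adj \<le>
        ennreal (6147 * (real (num_edges n adj) / (\<epsilon>\<^sup>2 * real (min_cut n adj)))
                   * (1 + ln (real n / \<epsilon>)) ^ 1)"
    using success_prob_min_cut_tree expected_queries_min_cut_tree by simp
qed

end
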